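(* Fix integers $g\ge 1$ and $n\ge 1$, and let $t=2g+n-1$. For a tuple $\beta=(\beta_1,\ldots,\beta_n)$ of positive integers with $d=\beta_1+\cdots+\beta_n$, the number $\mathsf{H}^g_{d,d}(\beta)/(t!\,d)$ is given by a symmetric polynomial in $\beta_1,\ldots,\beta_n$ of highest degree $4g+n-3$ and lowest degree $2g+n-3$. For nonnegative integers $b_1,\ldots,b_n$ with $b=b_1+\cdots+b_n\ge 2g-3$ and $b+2k=4g+n-3$ for an integer $k\ge 0$, the coefficient of $\beta_1^{b_1}\cdots\beta_n^{b_n}$ satisfies $$(-1)^{\frac{4g-3+n-b}{2}}\langle\langle\tau_{b_1}\cdots\tau_{b_n}\Lambda_{2k}\rangle\rangle'_g=\mathbf{C}_{b,g,n}\,\widehat{\mathbf{C}}_g(b_1,\ldots,b_n),$$ where $$\widehat{\mathbf{C}}_g(b_1,\ldots,b_n)=[x^{2g+n-3}]\,(2g+n-3)!\,(b+3-2g)!\prod_{i=1}^n\frac{(x+1)^{b_i+1}-(x-1)^{b_i+1}}{(b_i+1)!}.$$ In particular, if $b+n$ is even then $\langle\langle\tau_{b_1}\cdots\tau_{b_n}\Lambda_{2k}\rangle\rangle'_g=0$. Moreover, if $b_1+\cdots+b_n=2g+n-3$, then $$\langle\langle\tau_{b_1}\cdots\tau_{b_n}\Lambda_{2g}\rangle\rangle'_g=(-1)^g\binom{2g+n-3}{b_1,\ldots,b_n}\frac{1-2^{2g-1}}{2^{2g-1}(2g)!}B_{2g}.$$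
   Context: For a partition $\beta=[1^{a_1},\ldots,d^{a_d}]\vdash d$ with $n$ parts (a tuple is identified with its sorted partition), $\mathrm{Aut}(\beta)=\prod_i a_i!$, and $\mathsf{H}^g_{d,d}(\beta)=\frac{\mathrm{Aut}(\beta)}{d!}N$ where $N$ is the number of tuples $(\sigma_0,\tau_1,\ldots,\tau_t,\sigma_{t+1})$ in $\mathfrak{S}_d$, $t=2g-1+n$, with $\sigma_0$ a $d$-cycle, each $\tau_i$ a transposition, $\sigma_{t+1}$ of cycle type $\beta$, and $\sigma_0\tau_1\cdots\tau_t\sigma_{t+1}$ equal to the identity (i.e., having $d$ cycles). For $b_i\ge0$, $k\ge 0$ with $b_1+\cdots+b_n+2k=4g-3+n$, define $\langle\langle\tau_{b_1}\cdots\tau_{b_n}\Lambda_{2k}\rangle\rangle'_g=(-1)^k[\beta_1^{b_1}\cdots\beta_n^{b_n}]\frac{\mathsf{H}^g_{d,d}(\beta)}{t!\,d}$ (coefficient in the polynomial above), and set it to $0$ otherwise. $\mathbf{C}_{b,g,n}=\frac{1}{(b+3-2g)!}\sum_{k=0}^{2g+n}\frac{1}{(k+2g-b-3)!}\frac{B_{2g+n-k}}{(2g+n-k)!2^k}$ with $1/r!=0$ for $r<0$, where $B_r$ are the Bernoulli numbers, $\frac{x}{e^x-1}=\sum_r B_r\frac{x^r}{r!}$. $[x^j]$ denotes coefficient extraction. *)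

theory Defs
  imports "HOL-Combinatorics.Combinatorics" "HOL-Computational_Algebra.Computational_Algebra"
begin

(* Bernoulli numbers via x/(e^x - 1) = sum_r B_r x^r / r!  (so B_1 = -1/2) *)
definition bernoulli_num :: "nat \<Rightarrow> real" where
  "bernoulli_num r = fact r * fps_nth (fps_X / (fps_exp 1 - 1)) r"

definition inv_fact :: "int \<Rightarrow> real" where
  "inv_fact r = (if r < 0 then 0 else 1 / fact (nat r))"

definition orbit_of :: "(nat \<Rightarrow> nat) \<Rightarrow> nat \<Rightarrow> nat set" where
  "orbit_of \<sigma> x = {(\<sigma> ^^ k) x | k. True}"

definition cycle_type :: "nat \<Rightarrow> (nat \<Rightarrow> nat) \<Rightarrow> nat multiset" where
  "cycle_type d \<sigma> = image_mset card (mset_set (orbit_of \<sigma> ` {0..<d}))"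

definition is_transposition_on :: "nat \<Rightarrow> (nat \<Rightarrow> nat) \<Rightarrow> bool" where
  "is_transposition_on d \<tau> \<longleftrightarrow> (\<exists>a b. a < d \<and> b < d \<and> a \<noteq> b \<and> \<tau> = transpose a b)"

definition hurwitz_count :: "nat \<Rightarrow> nat list \<Rightarrow> nat" where
  "hurwitz_count g \<beta> =
     (let d = sum_list \<beta>; n = length \<beta>; t = 2 * g - 1 + n in
      card {(\<sigma>0, \<tau>s, \<sigma>1).
              \<sigma>0 permutes {0..<d} \<and> cycle_type d \<sigma>0 = {#d#} \<and>
              length \<tau>s = t \<and> (\<forall>\<tau>\<in>set \<tau>s. is_transposition_on d \<tau>) \<and>
              \<sigma>1 permutes {0..<d} \<and> cycle_type d \<sigma>1 = mset \<beta> \<and>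
              \<sigma>0 \<circ> foldr (\<circ>) \<tau>s id \<circ> \<sigma>1 = id})"

definition aut :: "nat list \<Rightarrow> nat" where
  "aut \<beta> = (\<Prod>i\<in>set \<beta>. fact (count (mset \<beta>) i))"

definition H_dd :: "nat \<Rightarrow> nat list \<Rightarrow> real" where
  "H_dd g \<beta> = real (aut \<beta>) / fact (sum_list \<beta>) * real (hurwitz_count g \<beta>)"

(* Multivariate polynomials in n variables represented by coefficient functions on
   exponent vectors (lists of length n) with finite support *)
definition is_poly_coeffs :: "nat \<Rightarrow> (nat list \<Rightarrow> real) \<Rightarrow> bool" where
  "is_poly_coeffs n c \<longleftrightarrow> finite {e. c e \<noteq> 0} \<and> (\<forall>e. c e \<noteq> 0 \<longrightarrow> length e = n)"

definition poly_eval :: "(nat list \<Rightarrow> real) \<Rightarrow> nat list \<Rightarrow> real" where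
  "poly_eval c \<beta> = (\<Sum>e\<in>{e. c e \<noteq> 0}. c e * (\<Prod>i<length \<beta>. real (\<beta> ! i) ^ (e ! i)))"

definition symmetric_coeffs :: "nat \<Rightarrow> (nat list \<Rightarrow> real) \<Rightarrow> bool" where
  "symmetric_coeffs n c \<longleftrightarrow> (\<forall>p e. p permutes {..<n} \<and> length e = n \<longrightarrow> c (permute_list p e) = c e)"

(* <<tau_{b_1} ... tau_{b_n} Lambda_{2k}>>'_g, where c is the coefficient function of the
   polynomial H^g_{d,d}(beta)/(t! d) *)
definition dbracket :: "(nat list \<Rightarrow> real) \<Rightarrow> nat \<Rightarrow> nat list \<Rightarrow> nat \<Rightarrow> real" where
  "dbracket c g bs k =
     (if sum_list bs + 2 * k = 4 * g - 3 + length bs then (-1) ^ k * c bs else 0)"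

definition C_const :: "nat \<Rightarrow> nat \<Rightarrow> nat \<Rightarrow> real" where
  "C_const b g n = inv_fact (int b + 3 - 2 * int g) *
     (\<Sum>k=0..2*g+n. inv_fact (int k + 2 * int g - int b - 3) *
        bernoulli_num (2*g+n-k) / (fact (2*g+n-k) * 2 ^ k))"

definition Chat :: "nat \<Rightarrow> nat list \<Rightarrow> real" where
  "Chat g bs = (let n = length bs; b = sum_list bs in
     fact (2*g+n-3) * fact (nat (int b + 3 - 2 * int g)) *
     coeff (\<Prod>i<n. smult (1 / fact (bs ! i + 1))
                 ([:1, 1:] ^ (bs ! i + 1) - [:-1, 1:] ^ (bs ! i + 1))) (2*g+n-3))"

definition multinomial_coeff :: "nat list \<Rightarrow> real" where
  "multinomial_coeff bs = fact (sum_list bs) / (\<Prod>i<length bs. fact (bs ! i))"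

end

theory Submission
  imports Defs
begin

text \<open>
  Attach to a permutation \<open>\<sigma>\<close> of a \<open>d\<close>-element set the series
  \<open>G\<^sub>\<sigma>(x) = (\<Prod>\<^bsub>C\<^esub> 2 sinh (|C| x / 2)) / (2 sinh (x / 2))\<close>, the product being over the cycles of
  \<open>\<sigma>\<close>. Multiplication by a transposition cuts a cycle or joins two, and the addition theorems for
  \<open>sinh\<close> and \<open>coth\<close> turn this into \<open>\<Sum>\<^sub>\<tau> G\<^bsub>\<tau>\<sigma>\<^esub> = d \<cdot> G\<^sub>\<sigma>'\<close>. As \<open>G\<^sub>\<sigma>(0)\<close> is \<open>d\<close> for a \<open>d\<close>-cycle
  and \<open>0\<close> otherwise, iterating \<open>t\<close> times and taking constant coefficients counts the factorizations:
  there are \<open>t! d\<^bsup>t-1\<^esup> [x\<^sup>t] G\<^sub>\<sigma>\<close> of them. Together with the size of the conjugacy class this is the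
  formula of Goulden, Jackson and Vakil,
  \<open>H / (t! d) = d\<^bsup>t-2\<^esup> [x\<^bsup>2g\<^esup>] (\<Prod>\<^sub>i S(\<beta>\<^sub>i x)) / S(x)\<close> with \<open>S(x) = sinh (x/2) / (x/2)\<close>.
  The power \<open>d\<^sup>N\<close> is \<open>N!\<close> times the \<open>y\<^sup>N\<close>-coefficient of \<open>e\<^bsup>dy\<^esup>\<close>, so the coefficients come from expanding
  each \<open>e\<^bsup>ayz/2\<^esup> S(az)\<close>, \<open>a = \<beta>\<^sub>i\<close>, in the central differences \<open>((y+1)\<^bsup>b+1\<^esup> - (y-1)\<^bsup>b+1\<^esup>) / (b+1)!\<close>, and
  from \<open>1 / S(x) = e\<^bsup>x/2\<^esup> x / (e\<^sup>x - 1)\<close>; the lowest degree is attained because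
  \<open>B\<^bsub>2g\<^esub> \<noteq> 0\<close>.
\<close>

section \<open>Cycles of a permutation\<close>

definition cycle_lengths :: "'a set \<Rightarrow> ('a \<Rightarrow> 'a) \<Rightarrow> nat multiset" where
  "cycle_lengths A f = image_mset card (mset_set (orbit f ` A))"

definition traces_cycle :: "('a \<Rightarrow> 'a) \<Rightarrow> 'a list \<Rightarrow> bool" where
  "traces_cycle f xs \<longleftrightarrow> xs \<noteq> [] \<and> distinct xs \<and> map f xs = rotate1 xs"

lemma permutes_self_in_orbit: "f permutes A \<Longrightarrow> finite A \<Longrightarrow> x \<in> orbit f x"
  by (simp add: permutation_self_in_orbit permutes_imp_permutation)

lemma permutes_orbit_eq:
  assumes "f permutes A" "finite A" "y \<in> orbit f x"
  shows "orbit f y = orbit f x"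
  using orbit_cyclic_eq3[OF cyclic_on_orbit[OF assms(1,2)] assms(3)] .

lemma permutes_in_orbit_commute:
  assumes "f permutes A" "finite A"
  shows "y \<in> orbit f x \<longleftrightarrow> x \<in> orbit f y"
  using orbit_swap permutes_self_in_orbit[OF assms] by metis

lemma cycle_type_eq_cycle_lengths:
  assumes "f permutes {0..<d}"
  shows "cycle_type d f = cycle_lengths {0..<d} f"
proof -
  have "orbit_of f = orbit f"
    using orbit_altdef_permutation[OF permutes_imp_permutation[OF finite_atLeastLessThan assms]]
    by (auto simp: orbit_of_def fun_eq_iff)
  then show ?thesis by (simp add: cycle_type_def cycle_lengths_def)
qed

lemma orbit_subset_invariant:
  assumes "f ` S \<subseteq> S" "x \<in> S"
  shows "orbit f x \<subseteq> S"
proof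
  fix y assume "y \<in> orbit f x"
  then show "y \<in> S" by induction (use assms in auto)
qed

lemma cycle_lengths_cong:
  assumes "f ` A \<subseteq> A" "\<And>x. x \<in> A \<Longrightarrow> f x = h x"
  shows "cycle_lengths A f = cycle_lengths A h"
proof -
  have "orbit f ` A = orbit h ` A"
    using assms by (intro image_cong refl orbit_cong0[of _ A]) auto
  then show ?thesis by (simp add: cycle_lengths_def)
qed

lemma cycle_lengths_Un_disjoint:
  assumes "finite A" "finite B" "A \<inter> B = {}" "f ` A \<subseteq> A" "f ` B \<subseteq> B"
  shows "cycle_lengths (A \<union> B) f = cycle_lengths A f + cycle_lengths B f"
proof -
  have "orbit f x \<noteq> orbit f y" if "x \<in> A" "y \<in> B" for x y
    using orbit_subset_invariant[OF assms(4) that(1)] orbit_subset_invariant[OF assms(5) that(2)]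
      orbit_nonempty[of f x] assms(3) by blast
  then have "orbit f ` A \<inter> orbit f ` B = {}" by blast
  then show ?thesis
    using assms(1,2) by (simp add: cycle_lengths_def image_Un mset_set_Union)
qed

lemma cycle_lengths_inv:
  assumes "f permutes A" "finite A"
  shows "cycle_lengths A (inv f) = cycle_lengths A f"
  by (simp add: cycle_lengths_def orbit_inv_eq permutes_imp_permutation[OF assms(2,1)])

lemma sum_over_orbits:
  fixes w :: "nat \<Rightarrow> 'b :: comm_semiring_1"
  assumes "f permutes A" "finite A"
  shows "(\<Sum>x\<in>A. w (card (orbit f x))) = (\<Sum>m\<in>#cycle_lengths A f. of_nat m * w m)"
proof -
  have fibre: "{x\<in>A. orbit f x = orbit f y} = orbit f y" if "y \<in> A" for y
    using that permutes_orbit_subset[OF assms(1)] permutes_orbit_eq[OF assms]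
      permutes_self_in_orbit[OF assms] by blast
  have "(\<Sum>x\<in>A. w (card (orbit f x))) = (\<Sum>C\<in>orbit f ` A. \<Sum>x\<in>{x\<in>A. orbit f x = C}. w (card C))"
    by (subst sum.image_gen[OF assms(2), of _ "orbit f"]) (auto intro!: sum.cong)
  also have "\<dots> = (\<Sum>C\<in>orbit f ` A. of_nat (card C) * w (card C))"
    by (intro sum.cong refl) (auto simp: fibre)
  finally show ?thesis
    by (simp add: cycle_lengths_def sum_unfold_sum_mset image_mset.compositionality comp_def)
qed

lemma sum_mset_cycle_lengths:
  assumes "f permutes A" "finite A"
  shows "sum_mset (cycle_lengths A f) = card A"
  using sum_over_orbits[OF assms, of "\<lambda>_. 1 :: nat"] by simp

lemma card_in_cycles_of_length:
  assumes "f permutes A" "finite A"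
  shows "card {x\<in>A. card (orbit f x) = m} = m * count (cycle_lengths A f) m"
proof -
  have "card {x\<in>A. card (orbit f x) = m} = (\<Sum>x\<in>A. if card (orbit f x) = m then 1 else 0)"
    using assms(2) by (simp add: sum.If_cases Int_def)
  also have "\<dots> = (\<Sum>k\<in>#cycle_lengths A f. k * (if k = m then 1 else 0))"
    using sum_over_orbits[OF assms, of "\<lambda>k. if k = m then 1 else 0 :: nat"] by simp
  also have "\<dots> = (\<Sum>k\<in>#cycle_lengths A f. if k = m then m else 0)"
    by (intro arg_cong[of _ _ sum_mset] image_mset_cong) simp
  finally show ?thesis by (simp add: sum_mset_delta)
qed

lemma card_orbit_pos:
  assumes "f permutes A" "finite A"
  shows "card (orbit f x) > 0"
  using finite_orbit[OF permutes_self_in_orbit[OF assms]] by (simp add: card_gt_0_iff orbit_nonempty)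

lemma cycle_lengths_pos:
  "f permutes A \<Longrightarrow> finite A \<Longrightarrow> m \<in># cycle_lengths A f \<Longrightarrow> m > 0"
  by (auto simp: cycle_lengths_def card_orbit_pos)

lemma traces_cycle_image: "traces_cycle f xs \<Longrightarrow> f ` set xs = set xs"
  unfolding traces_cycle_def by (metis set_map set_rotate1)

lemma traces_cycle_funpow:
  assumes "traces_cycle f xs"
  shows "map (f ^^ k) xs = rotate k xs"
proof (induction k)
  case (Suc k)
  have "map (f ^^ Suc k) xs = map f (rotate k xs)"
    by (simp flip: Suc.IH)
  also have "\<dots> = rotate (Suc k) xs"
    using assms by (simp add: traces_cycle_def rotate1_rotate_swap flip: rotate_map)
  finally show ?case .
qed simp

lemma traces_cycle_nth:
  assumes "traces_cycle f xs" "i < length xs"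
  shows "xs ! i = (f ^^ i) (hd xs)"
proof -
  have "(f ^^ i) (hd xs) = hd (map (f ^^ i) xs)"
    using assms(1) by (simp add: hd_map traces_cycle_def)
  then show ?thesis
    using assms by (simp add: traces_cycle_funpow hd_rotate_conv_nth traces_cycle_def)
qed

lemma traces_cycle_orbit:
  assumes "traces_cycle f xs" "x \<in> set xs"
  shows "orbit f x = set xs"
proof -
  have nonempty: "xs \<noteq> []" using assms(1) by (simp add: traces_cycle_def)
  have "(f ^^ length xs) (hd xs) = hd (map (f ^^ length xs) xs)" using nonempty by (simp add: hd_map)
  then have period: "(f ^^ length xs) (hd xs) = hd xs" by (simp add: traces_cycle_funpow[OF assms(1)])
  have "orbit f (hd xs) = {(f ^^ i) (hd xs) | i. i < length xs}"
    using nonempty by (intro orbit_altdef_bounded period) simp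
  also have "\<dots> = set xs"
    unfolding set_conv_nth using traces_cycle_nth[OF assms(1)] by (intro Collect_cong) metis
  finally have "cyclic_on f (set xs)"
    using nonempty by (intro cyclic_on_singleI[of "hd xs"]) auto
  then show ?thesis using assms(2) by (rule orbit_cyclic_eq3)
qed

lemma traces_cycle_card_orbit:
  "traces_cycle f xs \<Longrightarrow> x \<in> set xs \<Longrightarrow> card (orbit f x) = length xs"
  by (simp add: traces_cycle_orbit distinct_card traces_cycle_def)

lemma traces_cycle_unique:
  assumes "traces_cycle f xs" "traces_cycle f ys" "hd xs = hd ys"
  shows "xs = ys"
proof (rule nth_equalityI)
  have "hd xs \<in> set xs" "hd ys \<in> set ys" using assms(1,2) by (simp_all add: traces_cycle_def)
  then show "length xs = length ys" using assms traces_cycle_card_orbit by metis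
  then show "xs ! i = ys ! i" if "i < length xs" for i
    using that assms by (simp add: traces_cycle_nth)
qed

lemma traces_cycle_exists:
  assumes "permutation f"
  obtains xs where "traces_cycle f xs" "hd xs = x"
proof
  let ?xs = "support f x"
  have pos: "least_power f x > 0" using least_power_of_permutation(2)[OF assms] .
  have "map f ?xs = map (cycle_of_list ?xs) ?xs"
    using cycle_restrict[OF assms] by (intro map_cong) auto
  also have "\<dots> = rotate1 ?xs"
    using cyclic_rotation[OF cycle_of_permutation[OF assms], of 1] by simp
  finally show "traces_cycle f ?xs"
    using pos cycle_of_permutation[OF assms, of x] by (simp add: traces_cycle_def)
  show "hd ?xs = x" using pos by (simp add: hd_map)
qed

lemma traces_cycle_subset:
  assumes "traces_cycle f xs" "f permutes A" "hd xs \<in> A"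
  shows "set xs \<subseteq> A"
  using permutes_orbit_subset[OF assms(2,3)] traces_cycle_orbit[OF assms(1), of "hd xs"] assms(1)
  by (simp add: traces_cycle_def)

lemma cycle_lengths_remove_cycle:
  assumes "finite A" "inj f" "f ` A = A" "traces_cycle f xs" "set xs \<subseteq> A"
  shows "cycle_lengths A f = add_mset (length xs) (cycle_lengths (A - set xs) f)"
proof -
  note invariant = traces_cycle_image[OF assms(4)]
  have "orbit f ` set xs = {set xs}"
    using traces_cycle_orbit[OF assms(4)] assms(4) by (simp add: traces_cycle_def image_constant_conv)
  then have "cycle_lengths (set xs) f = {#length xs#}"
    using assms(4) by (simp add: cycle_lengths_def traces_cycle_def distinct_card)
  moreover have "f ` (A - set xs) = A - set xs"
    by (simp add: image_set_diff[OF assms(2)] assms(3) invariant)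
  ultimately have "cycle_lengths (set xs \<union> (A - set xs)) f
      = add_mset (length xs) (cycle_lengths (A - set xs) f)"
    using assms(1) invariant by (subst cycle_lengths_Un_disjoint) auto
  then show ?thesis using assms(5) by (simp add: Un_absorb1)
qed

lemma cycle_lengths_remove_two_cycles:
  assumes "finite A" "inj f" "f ` A = A" "traces_cycle f xs" "traces_cycle f ys"
    and "set xs \<subseteq> A" "set ys \<subseteq> A" "set xs \<inter> set ys = {}"
  shows "cycle_lengths A f = {#length xs, length ys#} + cycle_lengths (A - (set xs \<union> set ys)) f"
proof -
  have "f ` (A - set xs) = A - set xs"
    by (simp add: image_set_diff[OF assms(2)] assms(3) traces_cycle_image[OF assms(4)])
  then have "cycle_lengths (A - set xs) f = add_mset (length ys) (cycle_lengths (A - set xs - set ys) f)"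
    using assms by (intro cycle_lengths_remove_cycle) auto
  then show ?thesis
    using cycle_lengths_remove_cycle[OF assms(1-4,6)] by (simp add: Diff_eq Int_assoc)
qed

section \<open>Multiplication by a transposition\<close>

lemma transpose_comp_permutes:
  "f permutes A \<Longrightarrow> a \<in> A \<Longrightarrow> b \<in> A \<Longrightarrow> (transpose a b \<circ> f) permutes A"
  by (intro permutes_compose permutes_swap_id)

lemma traces_cycle_split:
  assumes "traces_cycle f (a # us @ b # vs)"
  shows "traces_cycle (transpose a b \<circ> f) (a # us)" "traces_cycle (transpose a b \<circ> f) (b # vs)"
proof -
  have distinct: "distinct (a # us @ b # vs)" using assms by (simp add: traces_cycle_def)
  have "map f (a # us) @ map f (b # vs) = (us @ [b]) @ (vs @ [a])"
    using assms by (simp add: traces_cycle_def)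
  then have images: "map f (a # us) = us @ [b]" "map f (b # vs) = vs @ [a]"
    by (subst (asm) append_eq_append_conv; simp)+
  have fixed: "map (transpose a b) us = us" "map (transpose a b) vs = vs"
    using distinct by (auto intro!: map_idI transpose_apply_other)
  have "map (transpose a b \<circ> f) (a # us) = us @ [a]"
    unfolding map_map[symmetric] images by (simp add: fixed)
  moreover have "map (transpose a b \<circ> f) (b # vs) = vs @ [b]"
    unfolding map_map[symmetric] images by (simp add: fixed)
  ultimately show "traces_cycle (transpose a b \<circ> f) (a # us)" "traces_cycle (transpose a b \<circ> f) (b # vs)"
    using distinct by (auto simp: traces_cycle_def)
qed

lemma traces_cycle_join:
  assumes "traces_cycle f (a # us)" "traces_cycle f (b # vs)" "set (a # us) \<inter> set (b # vs) = {}"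
  shows "traces_cycle (transpose a b \<circ> f) (a # us @ b # vs)"
proof -
  have distinct: "distinct (a # us @ b # vs)" using assms by (auto simp: traces_cycle_def)
  have images: "map f (a # us @ b # vs) = us @ [a] @ vs @ [b]"
    using assms by (simp add: traces_cycle_def)
  have "map (transpose a b) us = us" "map (transpose a b) vs = vs"
    using distinct by (auto intro!: map_idI transpose_apply_other)
  then have "map (transpose a b \<circ> f) (a # us @ b # vs) = us @ [b] @ vs @ [a]"
    unfolding map_map[symmetric] images by simp
  then show ?thesis using distinct by (auto simp: traces_cycle_def)
qed

lemma cycle_lengths_transpose_comp_rest:
  assumes "f permutes A" "f ` S = S" "a \<in> S" "b \<in> S"
  shows "cycle_lengths (A - S) (transpose a b \<circ> f) = cycle_lengths (A - S) f"
proof (rule cycle_lengths_cong[symmetric])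
  have rest: "f ` (A - S) = A - S"
    by (simp add: image_set_diff permutes_inj[OF assms(1)] permutes_image[OF assms(1)] assms(2))
  then show "f ` (A - S) \<subseteq> A - S" by simp
  show "f x = (transpose a b \<circ> f) x" if "x \<in> A - S" for x
  proof -
    have "f x \<notin> S" using that rest by blast
    then have "f x \<noteq> a" "f x \<noteq> b" using assms(3,4) by auto
    then show ?thesis by simp
  qed
qed

lemma cycle_lengths_cut:
  assumes perm: "f permutes A" "finite A"
    and traced: "traces_cycle f xs" "set xs \<subseteq> A" and index: "0 < i" "i < length xs"
  shows "cycle_lengths A (transpose (hd xs) (xs ! i) \<circ> f)
    = {#i, length xs - i#} + cycle_lengths (A - set xs) f"
proof -
  obtain a us where take_i: "take i xs = a # us" using index by (cases "take i xs") auto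
  define b vs where "b = xs ! i" and "vs = drop (Suc i) xs"
  have "xs = take i xs @ b # vs" unfolding b_def vs_def using index(2) by (rule id_take_nth_drop)
  then have split: "xs = a # us @ b # vs" by (simp add: take_i)
  then have "hd xs = a" by simp
  have lengths: "length (a # us) = i" "length (b # vs) = length xs - i"
    using index arg_cong[OF take_i, of length] by (auto simp: vs_def)
  have distinct: "distinct xs" using traced(1) by (simp add: traces_cycle_def)
  have members: "a \<in> set xs" "b \<in> set xs" by (auto simp: split)
  note parts = traces_cycle_split[OF traced(1)[unfolded split]]
  have parts_set: "set (a # us) \<union> set (b # vs) = set xs" by (auto simp: split)
  have product_perm: "(transpose a b \<circ> f) permutes A"
    using perm(1) traced(2) members by (intro transpose_comp_permutes) auto
  have "cycle_lengths A (transpose a b \<circ> f)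
      = {#i, length xs - i#} + cycle_lengths (A - set xs) (transpose a b \<circ> f)"
    using cycle_lengths_remove_two_cycles[OF perm(2) permutes_inj[OF product_perm]
        permutes_image[OF product_perm] parts] traced(2) distinct
    unfolding lengths parts_set by (auto simp: split)
  also have "cycle_lengths (A - set xs) (transpose a b \<circ> f) = cycle_lengths (A - set xs) f"
    using perm(1) traces_cycle_image[OF traced(1)] members by (rule cycle_lengths_transpose_comp_rest)
  finally show ?thesis using \<open>hd xs = a\<close> by (simp add: b_def comp_def)
qed

lemma cycle_lengths_join:
  assumes perm: "f permutes A" "finite A"
    and xs_traced: "traces_cycle f xs" "set xs \<subseteq> A"
    and ys_traced: "traces_cycle f ys" "set ys \<subseteq> A"
    and disjoint: "set xs \<inter> set ys = {}"
  shows "cycle_lengths A (transpose (hd xs) (hd ys) \<circ> f)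
    = {#length xs + length ys#} + cycle_lengths (A - (set xs \<union> set ys)) f"
proof -
  obtain a us b vs where split: "xs = a # us" "ys = b # vs"
    using xs_traced(1) ys_traced(1) by (auto simp: traces_cycle_def neq_Nil_conv)
  have product_perm: "(transpose a b \<circ> f) permutes A"
    using perm(1) xs_traced(2) ys_traced(2) by (intro transpose_comp_permutes) (auto simp: split)
  have "cycle_lengths A (transpose a b \<circ> f)
      = {#length (xs @ ys)#} + cycle_lengths (A - set (xs @ ys)) (transpose a b \<circ> f)"
    using cycle_lengths_remove_cycle[OF perm(2) permutes_inj[OF product_perm]
        permutes_image[OF product_perm], of "xs @ ys"] xs_traced(2) ys_traced(2) disjoint
      traces_cycle_join[OF xs_traced(1)[unfolded split] ys_traced(1)[unfolded split]]
    by (simp add: split)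
  also have "cycle_lengths (A - set (xs @ ys)) (transpose a b \<circ> f) = cycle_lengths (A - set (xs @ ys)) f"
    using perm(1) traces_cycle_image[OF xs_traced(1)] traces_cycle_image[OF ys_traced(1)]
    by (intro cycle_lengths_transpose_comp_rest) (auto simp: image_Un split)
  finally show ?thesis by (simp add: split comp_def insert_commute)
qed

definition transpositions :: "'a set \<Rightarrow> ('a \<Rightarrow> 'a) set" where
  "transpositions A = {transpose a b | a b. a \<in> A \<and> b \<in> A \<and> a \<noteq> b}"

lemma is_transposition_on_iff: "is_transposition_on d \<tau> \<longleftrightarrow> \<tau> \<in> transpositions {0..<d}"
  by (auto simp: is_transposition_on_def transpositions_def)

lemma transpositions_permute: "\<tau> \<in> transpositions A \<Longrightarrow> \<tau> permutes A"
  by (auto simp: transpositions_def intro: permutes_swap_id)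

lemma transpose_eq_transpose_iff:
  assumes "a \<noteq> b"
  shows "transpose c d = transpose a b \<longleftrightarrow> (c = a \<and> d = b) \<or> (c = b \<and> d = a)"
proof
  assume "transpose c d = transpose a b"
  then have "transpose c d a = b" by simp
  then show "(c = a \<and> d = b) \<or> (c = b \<and> d = a)" using assms by (auto simp: transpose_eq_iff)
qed (auto simp: transpose_commute)

lemma transpositions_eq_image:
  "transpositions A = (\<lambda>(a, b). transpose a b) ` (SIGMA a:A. A - {a})"
  by (auto simp: transpositions_def)

lemma finite_transpositions: "finite A \<Longrightarrow> finite (transpositions A)"
  by (simp add: transpositions_eq_image)

lemma sum_transpositions:
  fixes F :: "('a \<Rightarrow> 'a) \<Rightarrow> 'b :: comm_semiring_1"
  assumes "finite A"
  shows "(\<Sum>a\<in>A. \<Sum>b\<in>A - {a}. F (transpose a b)) = 2 * (\<Sum>\<tau>\<in>transpositions A. F \<tau>)"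
proof -
  let ?P = "SIGMA a:A. A - {a}" and ?t = "\<lambda>(a, b). transpose a b"
  have fibre: "(\<Sum>p\<in>{p\<in>?P. ?t p = \<tau>}. F (?t p)) = 2 * F \<tau>" if "\<tau> \<in> transpositions A" for \<tau>
  proof -
    obtain a b where transposed: "\<tau> = transpose a b" "a \<in> A" "b \<in> A" "a \<noteq> b"
      using \<open>\<tau> \<in> transpositions A\<close> by (auto simp: transpositions_def)
    then have "{p\<in>?P. ?t p = \<tau>} = {(a, b), (b, a)}"
      using transpose_eq_transpose_iff[of a b] by (auto simp: transpose_commute)
    then show ?thesis using transposed by (simp add: transpose_commute mult_2)
  qed
  have "(\<Sum>a\<in>A. \<Sum>b\<in>A - {a}. F (transpose a b)) = (\<Sum>p\<in>?P. F (?t p))"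
    using assms by (simp add: sum.Sigma case_prod_unfold)
  also have "\<dots> = (\<Sum>\<tau>\<in>transpositions A. \<Sum>p\<in>{p\<in>?P. ?t p = \<tau>}. F (?t p))"
    unfolding transpositions_eq_image using assms by (intro sum.image_gen) auto
  also have "\<dots> = (\<Sum>\<tau>\<in>transpositions A. 2 * F \<tau>)"
    using fibre by (intro sum.cong refl) auto
  finally show ?thesis by (simp add: sum_distrib_left)
qed

section \<open>Sizes of conjugacy classes\<close>

definition cycle_class :: "'a set \<Rightarrow> nat multiset \<Rightarrow> ('a \<Rightarrow> 'a) set" where
  "cycle_class A M = {f. f permutes A \<and> cycle_lengths A f = M}"

lemma finite_cycle_class: "finite A \<Longrightarrow> finite (cycle_class A M)"
  by (rule finite_subset[OF _ finite_permutations]) (auto simp: cycle_class_def)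

lemma map_cycle_of_list: "distinct xs \<Longrightarrow> map (cycle_of_list xs) xs = rotate1 xs"
  using cyclic_rotation[of xs 1] by simp

lemma cycle_of_list_comp:
  fixes xs
  assumes "finite A" "xs \<noteq> []" "distinct xs" "set xs \<subseteq> A" "\<rho> permutes (A - set xs)"
  defines "f \<equiv> cycle_of_list xs \<circ> \<rho>"
  shows "f permutes A" "traces_cycle f xs"
    "cycle_lengths A f = add_mset (length xs) (cycle_lengths (A - set xs) \<rho>)"
proof -
  show perm: "f permutes A"
    using cycle_permutes[of xs] assms(4,5) unfolding f_def
    by (intro permutes_compose) (auto intro: permutes_subset)
  have "map f xs = map (cycle_of_list xs) xs"
    unfolding f_def using assms(5) by (intro map_cong refl) (auto simp: permutes_not_in)
  then show traces: "traces_cycle f xs"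
    using assms(2,3) by (simp add: traces_cycle_def map_cycle_of_list del: map_eq_conv)
  have "cycle_lengths (A - set xs) \<rho> = cycle_lengths (A - set xs) f"
  proof (rule cycle_lengths_cong)
    show rest: "\<rho> ` (A - set xs) \<subseteq> A - set xs" using permutes_image[OF assms(5)] by simp
    show "\<rho> x = f x" if "x \<in> A - set xs" for x
      using that rest id_outside_supp[of "\<rho> x" xs] by (auto simp: f_def)
  qed
  then show "cycle_lengths A f = add_mset (length xs) (cycle_lengths (A - set xs) \<rho>)"
    using cycle_lengths_remove_cycle[OF assms(1) permutes_inj[OF perm] permutes_image[OF perm]
        traces assms(4)] by simp
qed

lemma card_cycle_class_tracing:
  assumes "finite A" "xs \<noteq> []" "distinct xs" "set xs \<subseteq> A"
  shows "card {f\<in>cycle_class A (add_mset (length xs) M). traces_cycle f xs}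
       = card (cycle_class (A - set xs) M)" (is "card ?F = card ?R")
proof -
  define c where "c = cycle_of_list xs"
  have c_permutes: "c permutes set xs" unfolding c_def by (rule cycle_permutes)
  note extend = cycle_of_list_comp[OF assms, folded c_def]
  have cancel: "inv c \<circ> (c \<circ> f) = f" "c \<circ> (inv c \<circ> f) = f" for f
    using permutes_inverses[OF c_permutes] by (auto simp: fun_eq_iff)
  have "bij_betw (\<lambda>\<rho>. c \<circ> \<rho>) ?R ?F"
  proof (rule bij_betw_byWitness[where f' = "\<lambda>f. inv c \<circ> f"])
    show "(\<lambda>\<rho>. c \<circ> \<rho>) ` ?R \<subseteq> ?F" using extend by (auto simp: cycle_class_def)
    show "(\<lambda>f. inv c \<circ> f) ` ?F \<subseteq> ?R"
    proof (rule image_subsetI)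
      fix f assume f_in: "f \<in> ?F"
      have fixed: "(inv c \<circ> f) x = x" if "x \<in> set xs" for x
      proof -
        have "map f xs = map c xs"
          using f_in assms(3) by (simp add: traces_cycle_def c_def map_cycle_of_list del: map_eq_conv)
        then show ?thesis using that permutes_inverses[OF c_permutes] by simp
      qed
      have "(inv c \<circ> f) permutes A"
        using f_in permutes_subset[OF permutes_inv[OF c_permutes] assms(4)]
        by (intro permutes_compose) (auto simp: cycle_class_def)
      then have perm: "(inv c \<circ> f) permutes (A - set xs)"
        by (rule permutes_superset) (use fixed in auto)
      then show "inv c \<circ> f \<in> ?R"
        using extend(3)[OF perm] f_in unfolding cancel by (simp add: cycle_class_def)
    qed
  qed (auto simp: cancel)
  then show ?thesis by (simp add: bij_betw_same_card)
qed

lemma card_traced_cycles: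
  assumes "f permutes A" "finite A"
  shows "card {xs\<in>{xs. length xs = m \<and> distinct xs \<and> set xs \<subseteq> A}. traces_cycle f xs}
    = m * count (cycle_lengths A f) m" (is "card ?X = _")
proof -
  have "bij_betw hd ?X {x\<in>A. card (orbit f x) = m}"
    unfolding bij_betw_def
  proof (intro conjI set_eqI iffI)
    show "inj_on hd ?X" by (auto simp: inj_on_def intro: traces_cycle_unique)
  next
    fix x assume "x \<in> hd ` ?X"
    then obtain xs where traced: "xs \<in> ?X" "x = hd xs" by auto
    then have "x \<in> set xs" by (auto simp: traces_cycle_def)
    then show "x \<in> {x\<in>A. card (orbit f x) = m}" using traced traces_cycle_card_orbit by auto
  next
    fix x assume x_in: "x \<in> {x\<in>A. card (orbit f x) = m}"
    obtain xs where traced: "traces_cycle f xs" "hd xs = x"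
      using traces_cycle_exists[OF permutes_imp_permutation[OF assms(2,1)]] .
    then have "x \<in> set xs" by (auto simp: traces_cycle_def)
    then have "xs \<in> ?X"
      using x_in traced traces_cycle_card_orbit[OF traced(1)] traces_cycle_subset[OF traced(1) assms(1)]
      by (auto simp: traces_cycle_def)
    then show "x \<in> hd ` ?X" using traced(2) by blast
  qed
  then show ?thesis using card_in_cycles_of_length[OF assms] by (simp add: bij_betw_same_card)
qed

text \<open>Permutations together with a traced cycle of length \<open>m\<close>, counted in two ways.\<close>

lemma card_cycle_class_add_mset:
  assumes "finite A" "m > 0"
  shows "card (cycle_class A (add_mset m M)) * (m * Suc (count M m))
    = (\<Sum>xs | length xs = m \<and> distinct xs \<and> set xs \<subseteq> A. card (cycle_class (A - set xs) M))"
proof -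
  let ?P = "cycle_class A (add_mset m M)"
  let ?L = "{xs. length xs = m \<and> distinct xs \<and> set xs \<subseteq> A}"
  have finite_L: "finite ?L"
    using finite_lists_length_eq[OF assms(1), of m] by (rule rev_finite_subset) auto
  have "card ?P * (m * Suc (count M m)) = (\<Sum>f\<in>?P. card {xs\<in>?L. traces_cycle f xs})"
    using card_traced_cycles[OF _ assms(1), of _ m] by (simp add: cycle_class_def)
  also have "\<dots> = (\<Sum>xs\<in>?L. card (cycle_class (A - set xs) M))"
  proof (rule sum_multicount_gen[OF finite_cycle_class[OF assms(1)] finite_L], rule ballI)
    fix xs assume "xs \<in> ?L"
    then show "card {f\<in>?P. traces_cycle f xs} = card (cycle_class (A - set xs) M)"
      using card_cycle_class_tracing[OF assms(1), of xs M] assms(2) by auto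
  qed
  finally show ?thesis .
qed

lemma aut_Cons: "aut (m # \<beta>) = aut \<beta> * Suc (count (mset \<beta>) m)"
proof -
  let ?f = "\<lambda>\<beta> i. fact (count (mset \<beta>) i) :: nat"
  have aut_eq: "aut \<beta>' = ?f \<beta>' m * (\<Prod>i\<in>set (m # \<beta>) - {m}. ?f \<beta>' i)"
    if "set \<beta>' \<subseteq> set (m # \<beta>)" for \<beta>'
  proof -
    have "aut \<beta>' = (\<Prod>i\<in>set (m # \<beta>). ?f \<beta>' i)"
      unfolding aut_def using that
      by (intro prod.mono_neutral_left) (auto simp: count_mset_0_iff[THEN iffD2])
    then show ?thesis by (subst (asm) prod.remove[of _ m]) auto
  qed
  have "(\<Prod>i\<in>set (m # \<beta>) - {m}. ?f (m # \<beta>) i) = (\<Prod>i\<in>set (m # \<beta>) - {m}. ?f \<beta> i)"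
    by (intro prod.cong) auto
  then show ?thesis using aut_eq[OF order_refl] aut_eq[OF set_subset_Cons] by (simp add: algebra_simps)
qed

theorem card_cycle_class:
  assumes "finite A" "\<forall>m\<in>set \<beta>. m > 0" "sum_list \<beta> = card A"
  shows "card (cycle_class A (mset \<beta>)) * prod_list \<beta> * aut \<beta> = fact (card A)"
  using assms
proof (induction \<beta> arbitrary: A)
  case Nil
  then have "A = {}" by simp
  then have "cycle_class A (mset []) = {id}" by (auto simp: cycle_class_def cycle_lengths_def)
  then show ?case using \<open>A = {}\<close> by (simp add: aut_def)
next
  case (Cons m \<beta>)
  let ?L = "{xs. length xs = m \<and> distinct xs \<and> set xs \<subseteq> A}" and ?d = "card A"
  have m_bounds: "m > 0" "m \<le> ?d" using Cons.prems by auto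
  have IH: "card (cycle_class (A - set xs) (mset \<beta>)) * (prod_list \<beta> * aut \<beta>) = fact (?d - m)"
    if "xs \<in> ?L" for xs
  proof -
    have "card (A - set xs) = ?d - m" using that Cons.prems(1)
      by (subst card_Diff_subset) (auto simp: distinct_card)
    then show ?thesis using Cons.IH[of "A - set xs"] Cons.prems by (simp add: mult.assoc)
  qed
  have "card (cycle_class A (mset (m # \<beta>))) * prod_list (m # \<beta>) * aut (m # \<beta>)
      = (card (cycle_class A (add_mset m (mset \<beta>))) * (m * Suc (count (mset \<beta>) m)))
        * (prod_list \<beta> * aut \<beta>)"
    by (simp add: aut_Cons mult_ac del: mult_Suc_right mult_Suc)
  also have "\<dots> = (\<Sum>xs\<in>?L. card (cycle_class (A - set xs) (mset \<beta>)) * (prod_list \<beta> * aut \<beta>))"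
    unfolding card_cycle_class_add_mset[OF Cons.prems(1) m_bounds(1)] by (rule sum_distrib_right)
  also have "\<dots> = card ?L * fact (?d - m)" using IH by simp
  also have "\<dots> = fact ?d"
    using card_lists_distinct_length_eq[OF Cons.prems(1) m_bounds(2)] fact_eq_fact_times[of "?d - m" ?d]
    by (simp add: mult.commute)
  finally show ?case .
qed

section \<open>Hyperbolic series\<close>

text \<open>The normalization is \<open>2 sinh (a x / 2)\<close> and \<open>2 cosh (a x / 2)\<close>, but
  \<open>sinh (a x / 2) / (a x / 2)\<close>.\<close>

definition sinh_fps :: "'a :: field_char_0 \<Rightarrow> 'a fps" where
  "sinh_fps a = fps_exp (a / 2) - fps_exp (- (a / 2))"

definition cosh_fps :: "'a :: field_char_0 \<Rightarrow> 'a fps" where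
  "cosh_fps a = fps_exp (a / 2) + fps_exp (- (a / 2))"

definition sinhc_fps :: "'a :: field_char_0 \<Rightarrow> 'a fps" where
  "sinhc_fps a = Abs_fps (\<lambda>k. if even k then (a / 2) ^ k / fact (k + 1) else 0)"

lemma sinh_fps_eq_sinhc: "sinh_fps a = fps_const a * fps_X * sinhc_fps a"
proof (rule fps_ext)
  fix k show "fps_nth (sinh_fps a) k = fps_nth (fps_const a * fps_X * sinhc_fps a) k"
  proof (cases k)
    case (Suc l)
    have "(- (a / 2)) ^ Suc l = (if even l then - 1 else 1) * (a / 2) ^ Suc l"
      by (simp only: power_minus[of "a / 2"]) simp
    then have "fps_nth (sinh_fps a) (Suc l) = (if even l then 2 * (a / 2) ^ Suc l / fact (Suc l) else 0)"
      by (simp add: sinh_fps_def del: fact_Suc power_Suc)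
    then show ?thesis using Suc by (simp add: sinhc_fps_def mult.assoc del: fact_Suc)
  qed (simp add: sinh_fps_def)
qed

lemma sinhc_fps_nth_0 [simp]: "fps_nth (sinhc_fps a) 0 = 1"
  by (simp add: sinhc_fps_def)

lemma sinhc_fps_nonzero [simp]: "sinhc_fps a \<noteq> 0"
  by (metis sinhc_fps_nth_0 fps_zero_nth zero_neq_one)

lemma sinh_fps_nonzero: "a \<noteq> 0 \<Longrightarrow> sinh_fps a \<noteq> 0"
  by (simp add: sinh_fps_eq_sinhc)

lemma sinh_fps_minus: "sinh_fps (- a) = - sinh_fps a"
  by (simp add: sinh_fps_def)

lemma sinh_fps_mult_cosh_fps: "sinh_fps a * cosh_fps b = sinh_fps (a + b) + sinh_fps (a - b)"
  unfolding sinh_fps_def cosh_fps_def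
  by (simp add: algebra_simps add_divide_distrib diff_divide_distrib flip: fps_exp_add_mult)

lemma sinh_fps_mult_sinh_fps: "sinh_fps a * sinh_fps b = cosh_fps (a + b) - cosh_fps (a - b)"
  unfolding sinh_fps_def cosh_fps_def
  by (simp add: algebra_simps add_divide_distrib diff_divide_distrib flip: fps_exp_add_mult)

lemma sinh_fps_add: "2 * sinh_fps (a + b) = sinh_fps a * cosh_fps b + sinh_fps b * cosh_fps a"
  using sinh_fps_minus[of "a - b"] by (simp add: sinh_fps_mult_cosh_fps add.commute)

lemma sinh_fps_diff: "2 * sinh_fps (a - b) = sinh_fps a * cosh_fps b - sinh_fps b * cosh_fps a"
  using sinh_fps_minus[of "a - b"] by (simp add: sinh_fps_mult_cosh_fps add.commute)

lemma sinh_fps_deriv: "2 * fps_deriv (sinh_fps a) = fps_const a * cosh_fps a"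
proof -
  have "2 * fps_deriv (sinh_fps a) = fps_const 2 * fps_const (a / 2) * cosh_fps a"
    by (simp add: sinh_fps_def cosh_fps_def numeral_fps_const algebra_simps del: fps_const_mult
        flip: fps_const_neg)
  then show ?thesis by simp
qed

lemma cosh_fps_deriv: "2 * fps_deriv (cosh_fps a) = fps_const a * sinh_fps a"
proof -
  have "2 * fps_deriv (cosh_fps a) = fps_const 2 * fps_const (a / 2) * sinh_fps a"
    by (simp add: sinh_fps_def cosh_fps_def numeral_fps_const algebra_simps del: fps_const_mult
        flip: fps_const_neg)
  then show ?thesis by simp
qed

text \<open>By the product formulas \<open>sinh 1 \<cdot> sinh i \<cdot> sinh (m - i)\<close> is \<open>sinh 1 \<cdot> cosh m\<close> up to a
  telescoping term.\<close>

lemma sum_sinh_fps_convolution: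
  assumes "m > 0"
  shows "sinh_fps 1 * (\<Sum>i\<in>{1..<m}. sinh_fps (of_nat i) * sinh_fps (of_nat (m - i)))
    = of_nat m * cosh_fps (of_nat m) * sinh_fps 1
      - cosh_fps 1 * sinh_fps (of_nat m :: 'a :: field_char_0)"
proof -
  define T where "T i = sinh_fps (2 * of_nat i - of_nat m - 1 :: 'a)" for i :: nat
  let ?p = "cosh_fps (of_nat m :: 'a) * sinh_fps 1"
  have summand: "sinh_fps 1 * (sinh_fps (of_nat i) * sinh_fps (of_nat (m - i))) = ?p - (T (Suc i) - T i)"
    if "i \<in> {1..<m}" for i
  proof -
    have "sinh_fps (of_nat i :: 'a) * sinh_fps (of_nat (m - i))
        = cosh_fps (of_nat m) - cosh_fps (2 * of_nat i - of_nat m)"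
      using that by (simp add: sinh_fps_mult_sinh_fps of_nat_diff)
    moreover have "sinh_fps 1 * cosh_fps (2 * of_nat i - of_nat m :: 'a) = T (Suc i) - T i"
      using sinh_fps_minus[of "1 - (2 * of_nat i - of_nat m) :: 'a"]
      by (simp add: sinh_fps_mult_cosh_fps T_def algebra_simps)
    ultimately show ?thesis by (simp add: right_diff_distrib mult.commute)
  qed
  have "sinh_fps 1 * (\<Sum>i\<in>{1..<m}. sinh_fps (of_nat i) * sinh_fps (of_nat (m - i)))
      = (\<Sum>i\<in>{1..<m}. ?p - (T (Suc i) - T i))"
    unfolding sum_distrib_left using summand by (rule sum.cong[OF refl])
  also have "\<dots> = of_nat (m - 1) * ?p - (T m - T 1)"
    using sum_Suc_diff'[of 1 m T] assms by (simp only: sum_subtractf) simp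
  also have "T m - T 1 = 2 * sinh_fps (of_nat m - 1)"
    using sinh_fps_minus[of "of_nat m - 1 :: 'a"] by (simp add: T_def)
  finally show ?thesis
    using assms unfolding sinh_fps_diff by (simp add: of_nat_diff algebra_simps)
qed

definition sinh_fls :: "'a :: field_char_0 \<Rightarrow> 'a fls" where
  "sinh_fls a = fps_to_fls (sinh_fps a)"

definition coth_fls :: "'a :: field_char_0 \<Rightarrow> 'a fls" where
  "coth_fls a = fps_to_fls (cosh_fps a) / sinh_fls a"

lemma sinh_fls_nonzero: "a \<noteq> 0 \<Longrightarrow> sinh_fls a \<noteq> 0"
  by (simp add: sinh_fls_def sinh_fps_nonzero)

lemma coth_fls_mult_sinh_fls: "a \<noteq> 0 \<Longrightarrow> coth_fls a * sinh_fls a = fps_to_fls (cosh_fps a)"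
  by (simp add: coth_fls_def sinh_fls_nonzero)

lemma sinh_fls_deriv:
  assumes "a \<noteq> 0"
  shows "2 * fls_deriv (sinh_fls a) = fls_const a * coth_fls a * sinh_fls a"
  using arg_cong[OF sinh_fps_deriv[of a], of fps_to_fls]
  by (simp add: sinh_fls_def[of a] fls_deriv_fps_to_fls fls_times_fps_to_fls mult.assoc
      coth_fls_mult_sinh_fls[OF assms, unfolded sinh_fls_def])

lemma sinh_fls_add:
  assumes "a \<noteq> 0" "b \<noteq> 0"
  shows "2 * sinh_fls (a + b) = (coth_fls a + coth_fls b) * (sinh_fls a * sinh_fls b)"
proof -
  have "2 * sinh_fls (a + b)
      = sinh_fls a * (coth_fls b * sinh_fls b) + sinh_fls b * (coth_fls a * sinh_fls a)"
    using arg_cong[OF sinh_fps_add[of a b], of fps_to_fls] assms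
    by (simp add: coth_fls_mult_sinh_fls) (simp add: sinh_fls_def fls_times_fps_to_fls)
  then show ?thesis by (simp add: algebra_simps)
qed

lemma fps_to_fls_sum: "fps_to_fls (sum h I) = (\<Sum>i\<in>I. fps_to_fls (h i))"
  by (induction I rule: infinite_finite_induct) auto

lemma sum_sinh_fls_convolution:
  assumes "m > 0"
  shows "(\<Sum>i\<in>{1..<m}. sinh_fls (of_nat i) * sinh_fls (of_nat (m - i)))
    = (of_nat m * coth_fls (of_nat m) - coth_fls 1) * sinh_fls (of_nat m :: 'a :: field_char_0)"
proof -
  have "sinh_fls (of_nat m :: 'a) \<noteq> 0" "sinh_fls (1 :: 'a) \<noteq> 0"
    using assms by (simp_all add: sinh_fls_nonzero)
  have "sinh_fls 1 * (\<Sum>i\<in>{1..<m}. sinh_fls (of_nat i) * sinh_fls (of_nat (m - i) :: 'a))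
      = of_nat m * fps_to_fls (cosh_fps (of_nat m)) * sinh_fls 1
        - fps_to_fls (cosh_fps 1) * sinh_fls (of_nat m)"
    using arg_cong[OF sum_sinh_fps_convolution[OF assms], of fps_to_fls]
    by (simp add: sinh_fls_def fls_times_fps_to_fls fps_to_fls_sum)
  also have "\<dots> = sinh_fls 1 * ((of_nat m * coth_fls (of_nat m) - coth_fls 1) * sinh_fls (of_nat m))"
    using assms by (simp add: algebra_simps flip: coth_fls_mult_sinh_fls)
  finally show ?thesis using \<open>sinh_fls 1 \<noteq> 0\<close> by simp
qed

section \<open>The cut-and-join equation\<close>

definition cycle_series :: "nat multiset \<Rightarrow> real fls" where
  "cycle_series M = (\<Prod>m\<in>#M. sinh_fls (real m)) / sinh_fls 1"

lemma prod_mset_sinh_fls_deriv: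
  assumes "\<forall>m\<in>#M. m > 0"
  shows "2 * fls_deriv (\<Prod>m\<in>#M. sinh_fls (real m))
    = (\<Prod>m\<in>#M. sinh_fls (real m)) * (\<Sum>m\<in>#M. of_nat m * coth_fls (real m))"
  using assms
proof (induction M)
  case (add m M)
  let ?P = "\<Prod>m\<in>#M. sinh_fls (real m)"
  have "2 * fls_deriv (sinh_fls (real m) * ?P)
      = sinh_fls (real m) * (2 * fls_deriv ?P) + 2 * fls_deriv (sinh_fls (real m)) * ?P"
    by (simp add: algebra_simps)
  also have "2 * fls_deriv ?P = ?P * (\<Sum>m\<in>#M. of_nat m * coth_fls (real m))" using add by simp
  also have "2 * fls_deriv (sinh_fls (real m)) = of_nat m * coth_fls (real m) * sinh_fls (real m)"
    using add.prems by (simp add: sinh_fls_deriv fls_of_nat)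
  finally show ?case by (simp add: algebra_simps)
qed simp

lemma cycle_series_deriv:
  assumes "\<forall>m\<in>#M. m > 0"
  shows "2 * fls_deriv (cycle_series M)
    = cycle_series M * ((\<Sum>m\<in>#M. of_nat m * coth_fls (real m)) - coth_fls 1)"
proof -
  let ?S = "\<Sum>m\<in>#M. of_nat m * coth_fls (real m)"
  have nonzero: "sinh_fls (1 :: real) \<noteq> 0" by (simp add: sinh_fls_nonzero)
  then have prod: "(\<Prod>m\<in>#M. sinh_fls (real m)) = cycle_series M * sinh_fls 1"
    by (simp add: cycle_series_def)
  have "2 * fls_deriv (cycle_series M) * sinh_fls 1 + cycle_series M * (2 * fls_deriv (sinh_fls 1))
      = 2 * fls_deriv (cycle_series M * sinh_fls 1)"
    by (simp add: algebra_simps)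
  also have "\<dots> = cycle_series M * sinh_fls 1 * ?S"
    using prod_mset_sinh_fls_deriv[OF assms] unfolding prod .
  finally have "2 * fls_deriv (cycle_series M) * sinh_fls 1
      = cycle_series M * (?S - coth_fls 1) * sinh_fls 1"
    unfolding sinh_fls_deriv[OF one_neq_zero] by (simp add: algebra_simps)
  then show ?thesis using nonzero by simp
qed

lemma bij_betw_nth_tail:
  assumes "distinct xs" "xs \<noteq> []"
  shows "bij_betw ((!) xs) {1..<length xs} (set xs - {hd xs})"
proof -
  have "bij_betw ((!) xs) ({..<length xs} - {0}) (set xs - {xs ! 0})"
    using assms by (intro bij_betw_DiffI bij_betw_singletonI bij_betw_nth) auto
  moreover have "{..<length xs} - {0} = {1..<length xs}" by auto
  ultimately show ?thesis using assms(2) by (simp add: hd_conv_nth)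
qed

lemma sum_cycle_series_cut:
  assumes perm: "f permutes A" "finite A" "a \<in> A"
  defines "m \<equiv> card (orbit f a)"
  shows "(\<Sum>b\<in>orbit f a - {a}. cycle_series (cycle_lengths A (transpose a b \<circ> f)))
       = cycle_series (cycle_lengths A f) * (of_nat m * coth_fls (real m) - coth_fls 1)"
proof -
  let ?G = "\<lambda>h. cycle_series (cycle_lengths A h)"
  obtain xs where traced: "traces_cycle f xs" "hd xs = a"
    using traces_cycle_exists[OF permutes_imp_permutation[OF perm(2,1)]] .
  then have "xs \<noteq> []" "distinct xs" "a \<in> set xs" by (auto simp: traces_cycle_def)
  then have orbit: "orbit f a = set xs" and m_eq: "length xs = m" "m > 0"
    using traces_cycle_orbit[OF traced(1)] by (auto simp: m_def distinct_card)
  have sub: "set xs \<subseteq> A" using traces_cycle_subset[OF traced(1) perm(1)] traced(2) perm(3) by simp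
  have cut: "?G (transpose a (xs ! i) \<circ> f) * sinh_fls (real m)
      = ?G f * (sinh_fls (real i) * sinh_fls (real (m - i)))" if "i \<in> {1..<m}" for i
    using cycle_lengths_cut[OF perm(1,2) traced(1) sub, of i] that m_eq(1) traced(2)
      cycle_lengths_remove_cycle[OF perm(2) permutes_inj[OF perm(1)] permutes_image[OF perm(1)]
        traced(1) sub]
    by (simp add: cycle_series_def)
  have "(\<Sum>b\<in>orbit f a - {a}. ?G (transpose a b \<circ> f)) * sinh_fls (real m)
      = (\<Sum>i\<in>{1..<m}. ?G (transpose a (xs ! i) \<circ> f) * sinh_fls (real m))"
    using sum.reindex_bij_betw[OF bij_betw_nth_tail[OF \<open>distinct xs\<close> \<open>xs \<noteq> []\<close>],
        of "\<lambda>b. ?G (transpose a b \<circ> f)", symmetric]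
    by (simp add: orbit m_eq(1) traced(2) sum_distrib_right)
  also have "\<dots> = ?G f * (\<Sum>i\<in>{1..<m}. sinh_fls (real i) * sinh_fls (real (m - i)))"
    unfolding sum_distrib_left using cut by (rule sum.cong[OF refl])
  also have "\<dots> = ?G f * (of_nat m * coth_fls (real m) - coth_fls 1) * sinh_fls (real m)"
    using sum_sinh_fls_convolution[OF m_eq(2), where 'a = real] by simp
  finally show ?thesis using m_eq(2) sinh_fls_nonzero[of "real m"] by simp
qed

lemma cycle_series_join:
  assumes perm: "f permutes A" "finite A" "a \<in> A" "b \<in> A" and "b \<notin> orbit f a"
  shows "2 * cycle_series (cycle_lengths A (transpose a b \<circ> f))
    = cycle_series (cycle_lengths A f)
      * (coth_fls (real (card (orbit f a))) + coth_fls (real (card (orbit f b))))"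
proof -
  obtain xs where xs_traced: "traces_cycle f xs" "hd xs = a"
    using traces_cycle_exists[OF permutes_imp_permutation[OF perm(2,1)]] .
  obtain ys where ys_traced: "traces_cycle f ys" "hd ys = b"
    using traces_cycle_exists[OF permutes_imp_permutation[OF perm(2,1)]] .
  have orbits: "orbit f a = set xs" "orbit f b = set ys"
    and lengths: "card (orbit f a) = length xs" "card (orbit f b) = length ys"
    using traces_cycle_orbit[OF xs_traced(1), of a] traces_cycle_orbit[OF ys_traced(1), of b]
      xs_traced ys_traced
    by (auto simp: traces_cycle_def distinct_card)
  have pos: "real (length xs) \<noteq> 0" "real (length ys) \<noteq> 0"
    using xs_traced(1) ys_traced(1) by (simp_all add: traces_cycle_def)
  have sub: "set xs \<subseteq> A" "set ys \<subseteq> A"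
    using traces_cycle_subset[OF xs_traced(1) perm(1)] traces_cycle_subset[OF ys_traced(1) perm(1)]
      xs_traced(2) ys_traced(2) perm(3,4) by simp_all
  have disjoint: "set xs \<inter> set ys = {}"
    using traces_cycle_orbit[OF xs_traced(1)] traces_cycle_orbit[OF ys_traced(1)] orbits assms(5)
      permutes_self_in_orbit[OF perm(1,2), of b] by (metis disjoint_iff)
  define R where "R = cycle_lengths (A - (set xs \<union> set ys)) f"
  have joined: "cycle_lengths A (transpose a b \<circ> f) = {#length xs + length ys#} + R"
    using cycle_lengths_join[OF perm(1,2) xs_traced(1) sub(1) ys_traced(1) sub(2) disjoint]
    by (simp only: R_def xs_traced ys_traced)
  have separate: "cycle_lengths A f = {#length xs, length ys#} + R"
    unfolding R_def by (rule cycle_lengths_remove_two_cycles[OF perm(2) permutes_inj[OF perm(1)]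
          permutes_image[OF perm(1)] xs_traced(1) ys_traced(1) sub disjoint])
  have "2 * cycle_series (cycle_lengths A (transpose a b \<circ> f))
      = 2 * sinh_fls (real (length xs) + real (length ys)) * (\<Prod>m\<in>#R. sinh_fls (real m)) / sinh_fls 1"
    by (simp add: joined cycle_series_def)
  then show ?thesis
    unfolding sinh_fls_add[OF pos] lengths separate by (simp add: cycle_series_def mult_ac)
qed

lemma sum_outside_orbit_swap:
  fixes w :: "'a \<Rightarrow> 'b :: comm_ring_1"
  assumes perm: "f permutes A" "finite A"
  shows "(\<Sum>a\<in>A. \<Sum>b\<in>A - orbit f a. w a + w b)
    = 2 * (\<Sum>a\<in>A. (of_nat (card A) - of_nat (card (orbit f a))) * w a)"
proof -
  have symmetric: "{a\<in>A. b \<notin> orbit f a} = A - orbit f b" for b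
    by (simp add: set_eq_iff permutes_in_orbit_commute[OF perm, of b])
  have "(\<Sum>a\<in>A. \<Sum>b\<in>A - orbit f a. w b) = (\<Sum>b\<in>A. \<Sum>a\<in>{a\<in>A. b \<notin> orbit f a}. w b)"
    unfolding set_diff_eq using perm(2) by (intro sum.swap_restrict)
  then have "(\<Sum>a\<in>A. \<Sum>b\<in>A - orbit f a. w b) = (\<Sum>b\<in>A. \<Sum>a\<in>A - orbit f b. w b)"
    unfolding symmetric .
  then have "(\<Sum>a\<in>A. \<Sum>b\<in>A - orbit f a. w a + w b) = 2 * (\<Sum>a\<in>A. \<Sum>b\<in>A - orbit f a. w a)"
    unfolding sum.distrib mult_2 by (rule arg_cong)
  moreover have "(\<Sum>b\<in>A - orbit f a. w a) = (of_nat (card A) - of_nat (card (orbit f a))) * w a"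
    if "a \<in> A" for a
    using permutes_orbit_subset[OF perm(1) that] perm(2)
    by (simp add: card_Diff_subset finite_subset card_mono of_nat_diff)
  ultimately show ?thesis by simp
qed

lemma sum_cycle_series_transpose:
  assumes perm: "f permutes A" "finite A" "a \<in> A"
  defines "\<kappa> \<equiv> \<lambda>x. coth_fls (real (card (orbit f x)))"
  shows "2 * (\<Sum>b\<in>A - {a}. cycle_series (cycle_lengths A (transpose a b \<circ> f)))
    = cycle_series (cycle_lengths A f)
      * (2 * (of_nat (card (orbit f a)) * \<kappa> a - coth_fls 1) + (\<Sum>b\<in>A - orbit f a. \<kappa> a + \<kappa> b))"
proof -
  let ?F = "\<lambda>b. cycle_series (cycle_lengths A (transpose a b \<circ> f))"
  have sub: "orbit f a \<subseteq> A" using permutes_orbit_subset[OF perm(1,3)] .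
  then have split: "A - {a} = (orbit f a - {a}) \<union> (A - orbit f a)"
    using permutes_self_in_orbit[OF perm(1,2), of a] by blast
  have "sum ?F (A - {a}) = sum ?F (orbit f a - {a}) + sum ?F (A - orbit f a)"
    unfolding split using perm(2) sub by (intro sum.union_disjoint) (auto intro: finite_subset)
  moreover have "2 * sum ?F (A - orbit f a)
      = cycle_series (cycle_lengths A f) * (\<Sum>b\<in>A - orbit f a. \<kappa> a + \<kappa> b)"
    unfolding sum_distrib_left \<kappa>_def using cycle_series_join[OF perm] by (intro sum.cong) auto
  ultimately show ?thesis
    using sum_cycle_series_cut[OF perm] by (simp add: \<kappa>_def distrib_left mult_ac)
qed

lemma cut_join_ordered:
  assumes perm: "f permutes A" "finite A"
  shows "(\<Sum>a\<in>A. \<Sum>b\<in>A - {a}. cycle_series (cycle_lengths A (transpose a b \<circ> f)))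
       = 2 * (of_nat (card A) * fls_deriv (cycle_series (cycle_lengths A f)))"
proof -
  let ?G = "cycle_series (cycle_lengths A f)"
    and ?F = "\<lambda>a b. cycle_series (cycle_lengths A (transpose a b \<circ> f))"
  define \<kappa> where "\<kappa> a = coth_fls (real (card (orbit f a)))" for a
  let ?outside = "\<lambda>a. \<Sum>b\<in>A - orbit f a. \<kappa> a + \<kappa> b"
    and ?inside = "\<lambda>a. 2 * (of_nat (card (orbit f a)) * \<kappa> a - coth_fls 1)"
  have "2 * (\<Sum>a\<in>A. \<Sum>b\<in>A - {a}. ?F a b) = (\<Sum>a\<in>A. ?G * (?inside a + ?outside a))"
    unfolding sum_distrib_left[of 2] \<kappa>_def
    using sum_cycle_series_transpose[OF perm] by (intro sum.cong refl) (simp add: sum_distrib_left)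
  also have "\<dots> = ?G * ((\<Sum>a\<in>A. ?inside a) + (\<Sum>a\<in>A. ?outside a))"
    by (simp only: sum_distrib_left[symmetric] sum.distrib[of ?inside ?outside])
  also have "(\<Sum>a\<in>A. ?inside a) + (\<Sum>a\<in>A. ?outside a)
      = (\<Sum>a\<in>A. 2 * (of_nat (card A) * \<kappa> a - coth_fls 1))"
    unfolding sum_outside_orbit_swap[OF perm] sum_distrib_left[of 2] sum.distrib[symmetric]
    by (intro sum.cong refl) (simp add: algebra_simps)
  also have "\<dots> = 2 * of_nat (card A) * ((\<Sum>a\<in>A. \<kappa> a) - coth_fls 1)"
    by (simp add: sum_subtractf right_diff_distrib sum_distrib_left mult.assoc)
  also have "(\<Sum>a\<in>A. \<kappa> a) = (\<Sum>k\<in>#cycle_lengths A f. of_nat k * coth_fls (real k))"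
    unfolding \<kappa>_def by (rule sum_over_orbits[OF perm])
  also have "?G * (2 * of_nat (card A) * (\<dots> - coth_fls 1)) = 2 * of_nat (card A) * (2 * fls_deriv ?G)"
    using cycle_series_deriv[of "cycle_lengths A f"] cycle_lengths_pos[OF perm] by simp
  finally show ?thesis by (simp add: mult.assoc comp_def)
qed

theorem cut_join:
  assumes "f permutes A" "finite A"
  shows "(\<Sum>\<tau>\<in>transpositions A. cycle_series (cycle_lengths A (\<tau> \<circ> f)))
       = of_nat (card A) * fls_deriv (cycle_series (cycle_lengths A f))"
  using cut_join_ordered[OF assms]
    sum_transpositions[OF assms(2), of "\<lambda>\<tau>. cycle_series (cycle_lengths A (\<tau> \<circ> f))"]
  by simp

section \<open>One-part double Hurwitz numbers\<close>

definition transposition_words :: "'a set \<Rightarrow> nat \<Rightarrow> ('a \<Rightarrow> 'a) list set" where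
  "transposition_words A t = {ts. set ts \<subseteq> transpositions A \<and> length ts = t}"

definition full_cycle_words :: "'a set \<Rightarrow> ('a \<Rightarrow> 'a) \<Rightarrow> nat \<Rightarrow> ('a \<Rightarrow> 'a) list set" where
  "full_cycle_words A f t
    = {ts\<in>transposition_words A t. cycle_lengths A (foldr (\<circ>) ts id \<circ> f) = {#card A#}}"

lemma finite_transposition_words: "finite A \<Longrightarrow> finite (transposition_words A t)"
  unfolding transposition_words_def by (rule finite_lists_length_eq[OF finite_transpositions])

lemma foldr_comp_permutes:
  assumes "\<forall>\<tau>\<in>set ts. \<tau> permutes A"
  shows "foldr (\<circ>) ts id permutes A"
  using assms
proof (induction ts)
  case (Cons \<tau> ts)
  have "foldr (\<circ>) (\<tau> # ts) id = \<tau> \<circ> foldr (\<circ>) ts id" by simp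
  moreover have "foldr (\<circ>) ts id permutes A" by (rule Cons.IH) (use Cons.prems in simp)
  moreover have "\<tau> permutes A" using Cons.prems by simp
  ultimately show ?case by (metis permutes_compose)
qed (simp add: permutes_id)

lemma transposition_word_comp_permutes:
  assumes "ts \<in> transposition_words A t" "f permutes A"
  shows "(foldr (\<circ>) ts id \<circ> f) permutes A"
  using assms transpositions_permute
  by (intro permutes_compose foldr_comp_permutes) (auto simp: transposition_words_def)

lemma cut_join_iterated:
  assumes "f permutes A" "finite A"
  shows "(\<Sum>ts\<in>transposition_words A t. cycle_series (cycle_lengths A (foldr (\<circ>) ts id \<circ> f)))
       = of_nat (card A ^ t) * (fls_deriv ^^ t) (cycle_series (cycle_lengths A f))"
proof (induction t)
  case 0
  have "transposition_words A 0 = {[]}" by (auto simp: transposition_words_def)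
  then show ?case by simp
next
  case (Suc t)
  let ?T = "transpositions A" and ?W = "transposition_words A t"
  let ?G = "\<lambda>h. cycle_series (cycle_lengths A h)"
  have words: "transposition_words A (Suc t) = (\<lambda>(ts, \<tau>). \<tau> # ts) ` (?W \<times> ?T)"
    unfolding transposition_words_def by (rule lists_length_Suc_eq)
  have "(\<Sum>ts\<in>transposition_words A (Suc t). ?G (foldr (\<circ>) ts id \<circ> f))
      = (\<Sum>(ts, \<tau>)\<in>?W \<times> ?T. ?G (\<tau> \<circ> (foldr (\<circ>) ts id \<circ> f)))"
    unfolding words by (subst sum.reindex) (auto intro!: sum.cong simp: inj_on_def comp_assoc)
  also have "\<dots> = (\<Sum>ts\<in>?W. \<Sum>\<tau>\<in>?T. ?G (\<tau> \<circ> (foldr (\<circ>) ts id \<circ> f)))"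
    by (simp add: sum.cartesian_product)
  also have "\<dots> = (\<Sum>ts\<in>?W. of_nat (card A) * fls_deriv (?G (foldr (\<circ>) ts id \<circ> f)))"
    using transposition_word_comp_permutes[OF _ assms(1)] by (intro sum.cong refl cut_join assms(2))
  also have "\<dots> = of_nat (card A) * fls_deriv (\<Sum>ts\<in>?W. ?G (foldr (\<circ>) ts id \<circ> f))"
    by (simp add: fls_deriv_sum sum_distrib_left)
  also have "\<dots> = of_nat (card A ^ Suc t) * (fls_deriv ^^ Suc t) (?G f)"
    unfolding Suc.IH fls_deriv_mult by (simp add: mult.assoc fls_of_nat flip: of_nat_power)
  finally show ?case .
qed

lemma fls_deriv_funpow_nth_0:
  "fls_nth ((fls_deriv ^^ t) F) 0 = fact t * fls_nth (F :: 'a :: field_char_0 fls) (int t)"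
  by (induction t arbitrary: F) (simp_all add: funpow_swap1 algebra_simps)

definition sinhc_ratio :: "nat multiset \<Rightarrow> real fps" where
  "sinhc_ratio M = (\<Prod>m\<in>#M. sinhc_fps (real m)) * inverse (sinhc_fps 1)"

lemma prod_mset_sinh_fls:
  "(\<Prod>m\<in>#M. sinh_fls (real m))
    = fps_to_fls (fps_const (real (prod_mset M)) * fps_X ^ size M * (\<Prod>m\<in>#M. sinhc_fps (real m)))"
  by (induction M)
    (simp_all add: sinh_fls_def sinh_fps_eq_sinhc fls_times_fps_to_fls mult_ac flip: fps_const_mult)

lemma cycle_series_eq_sinhc_ratio:
  assumes "M \<noteq> {#}"
  shows "cycle_series M
    = fps_to_fls (fps_const (real (prod_mset M)) * fps_X ^ (size M - 1) * sinhc_ratio M)"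
    (is "_ = fps_to_fls ?F")
proof -
  let ?c = "fps_const (real (prod_mset M))"
  have "sinh_fps 1 * ?F = ?c * (fps_X * fps_X ^ (size M - 1)) * (sinhc_fps 1 * sinhc_ratio M)"
    by (simp add: sinh_fps_eq_sinhc mult_ac)
  also have "fps_X * fps_X ^ (size M - 1) = (fps_X :: real fps) ^ size M"
    using assms by (cases "size M") auto
  also have "sinhc_fps 1 * sinhc_ratio M = (\<Prod>m\<in>#M. sinhc_fps (real m))"
    by (simp add: sinhc_ratio_def inverse_mult_eq_1' mult.left_commute[of "sinhc_fps 1"])
  finally have product: "sinh_fps 1 * ?F = ?c * fps_X ^ size M * (\<Prod>m\<in>#M. sinhc_fps (real m))" .
  have "sinh_fls 1 * fps_to_fls ?F = fps_to_fls (sinh_fps 1 * ?F)"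
    by (simp only: sinh_fls_def fls_times_fps_to_fls)
  also have "\<dots> = (\<Prod>m\<in>#M. sinh_fls (real m))"
    by (simp only: product prod_mset_sinh_fls)
  finally have "sinh_fls 1 * fps_to_fls ?F = (\<Prod>m\<in>#M. sinh_fls (real m))" .
  then show ?thesis
    using sinh_fls_nonzero[of "1 :: real"] by (simp add: cycle_series_def field_simps)
qed

lemma cycle_series_nth:
  assumes "M \<noteq> {#}"
  shows "fls_nth (cycle_series M) (int (size M - 1 + k))
    = real (prod_mset M) * fps_nth (sinhc_ratio M) k"
  unfolding cycle_series_eq_sinhc_ratio[OF assms]
  by (simp add: mult.assoc fps_X_power_mult_nth del: of_nat_add)

lemma cycle_series_nth_0:
  assumes "M \<noteq> {#}"
  shows "fls_nth (cycle_series M) 0 = (if size M = 1 then real (prod_mset M) else 0)"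
proof (cases "size M = 1")
  case True
  then obtain k where "M = {#k#}" using size_1_singleton_mset by blast
  then show ?thesis
    using cycle_series_nth[OF assms, of 0] by (simp add: sinhc_ratio_def)
next
  case False
  then have "size M - 1 > 0" using assms by (simp add: nonempty_has_size)
  then show ?thesis
    using False unfolding cycle_series_eq_sinhc_ratio[OF assms]
    by (simp add: mult.assoc fps_X_power_mult_nth)
qed

lemma cycle_lengths_eq_singleton_iff:
  assumes "f permutes A" "finite A"
  shows "cycle_lengths A f = {#card A#} \<longleftrightarrow> size (cycle_lengths A f) = 1"
proof
  assume "size (cycle_lengths A f) = 1"
  then obtain k where "cycle_lengths A f = {#k#}" using size_1_singleton_mset by blast
  then show "cycle_lengths A f = {#card A#}" using sum_mset_cycle_lengths[OF assms] by simp
qed simp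

theorem card_full_cycle_words:
  assumes "f permutes A" "finite A" "A \<noteq> {}"
  shows "real (card A) * real (card (full_cycle_words A f t))
    = real (card A) ^ t * fact t * fls_nth (cycle_series (cycle_lengths A f)) (int t)"
proof -
  let ?W = "transposition_words A t" and ?L = "\<lambda>ts. cycle_lengths A (foldr (\<circ>) ts id \<circ> f)"
  have nth_0: "fls_nth (cycle_series (?L ts)) 0 = (if ?L ts = {#card A#} then real (card A) else 0)"
    if "ts \<in> ?W" for ts
  proof -
    note perm = transposition_word_comp_permutes[OF that assms(1)]
    have "?L ts \<noteq> {#}"
      using sum_mset_cycle_lengths[OF perm assms(2)] assms(2,3) by auto
    then show ?thesis
      using cycle_lengths_eq_singleton_iff[OF perm assms(2)] by (auto simp: cycle_series_nth_0)
  qed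
  have "real (card A) * real (card (full_cycle_words A f t))
      = (\<Sum>ts\<in>?W. if ?L ts = {#card A#} then real (card A) else 0)"
    using finite_transposition_words[OF assms(2)] by (simp add: full_cycle_words_def sum.If_cases Int_def)
  also have "\<dots> = fls_nth (\<Sum>ts\<in>?W. cycle_series (?L ts)) 0"
    by (simp add: fls_nth_sum nth_0)
  also have "\<dots> = real (card A) ^ t * fact t * fls_nth (cycle_series (cycle_lengths A f)) (int t)"
    unfolding cut_join_iterated[OF assms(1,2)]
    by (simp add: fls_of_nat fls_deriv_funpow_nth_0 flip: of_nat_power)
  finally show ?thesis .
qed

lemma permutes_comp_eq_id_iff: "p permutes A \<Longrightarrow> q \<circ> p = id \<longleftrightarrow> q = inv p"
  using permutes_inv_o[of p A] by (metis comp_assoc comp_id id_comp)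

lemma hurwitz_count_eq_sum:
  fixes \<beta> g
  defines "A \<equiv> {0..<sum_list \<beta>}" and "t \<equiv> 2 * g - 1 + length \<beta>"
  shows "hurwitz_count g \<beta> = (\<Sum>f\<in>cycle_class A (mset \<beta>). card (full_cycle_words A f t))"
proof -
  let ?d = "sum_list \<beta>" and ?p = "\<lambda>ts f. foldr (\<circ>) ts id \<circ> f"
  let ?S = "SIGMA f:cycle_class A (mset \<beta>). full_cycle_words A f t"
  let ?tuple = "\<lambda>(f, ts). (inv (?p ts f), ts, f)"
  let ?X = "{(\<sigma>0, ts, f). \<sigma>0 permutes A \<and> cycle_type ?d \<sigma>0 = {#?d#} \<and> length ts = t \<and>
    (\<forall>\<tau>\<in>set ts. is_transposition_on ?d \<tau>) \<and> f permutes A \<and> cycle_type ?d f = mset \<beta> \<and>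
    \<sigma>0 \<circ> foldr (\<circ>) ts id \<circ> f = id}"
  have tuple_iff: "(\<sigma>0, ts, f) \<in> ?X \<longleftrightarrow> (f, ts) \<in> ?S \<and> \<sigma>0 = inv (?p ts f)" for \<sigma>0 ts f
  proof (cases "f permutes A \<and> ts \<in> transposition_words A t")
    case True
    then have perm: "?p ts f permutes A" using transposition_word_comp_permutes by blast
    have "cycle_type ?d (inv (?p ts f)) = cycle_lengths A (?p ts f)"
      using cycle_type_eq_cycle_lengths permutes_inv[OF perm] cycle_lengths_inv[OF perm]
      by (simp add: A_def)
    then show ?thesis
      using True permutes_inv[OF perm] permutes_comp_eq_id_iff[OF perm, of \<sigma>0]
        cycle_type_eq_cycle_lengths[of f ?d]
      by (auto simp: full_cycle_words_def cycle_class_def A_def transposition_words_def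
          is_transposition_on_iff comp_assoc)
  next
    case False
    then show ?thesis
      by (auto simp: cycle_class_def full_cycle_words_def transposition_words_def
          is_transposition_on_iff A_def)
  qed
  have "hurwitz_count g \<beta> = card ?X"
    by (simp add: hurwitz_count_def A_def t_def Let_def)
  also have "?X = ?tuple ` ?S"
    using tuple_iff by (auto simp: image_iff)
  also have "card (?tuple ` ?S) = card ?S"
    by (intro card_image) (auto simp: inj_on_def)
  finally show ?thesis
    using finite_cycle_class[of A] finite_transposition_words[of A]
    by (simp add: A_def full_cycle_words_def)
qed

theorem one_part_double_hurwitz:
  assumes "g \<ge> 1" "\<beta> \<noteq> []" "\<forall>m\<in>set \<beta>. m > 0"
  shows "H_dd g \<beta> / (fact (2 * g + length \<beta> - 1) * real (sum_list \<beta>))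
    = real (sum_list \<beta>) ^ (2 * g + length \<beta> - 3) * fps_nth (sinhc_ratio (mset \<beta>)) (2 * g)"
proof -
  define d where "d = sum_list \<beta>"
  define t where "t = 2 * g - 1 + length \<beta>"
  let ?C = "cycle_class {0..<d} (mset \<beta>)" and ?c = "fps_nth (sinhc_ratio (mset \<beta>)) (2 * g)"
  have d_pos: "d > 0" using assms(2,3) unfolding d_def by (cases \<beta>) auto
  have length: "length \<beta> > 0" using assms(2) by simp
  have t_eqs: "t = 2 * g + length \<beta> - 1" "t = 2 + (2 * g + length \<beta> - 3)" "t = length \<beta> - 1 + 2 * g"
    unfolding t_def using assms(1) length by arith+
  have "real d * real (hurwitz_count g \<beta>) = (\<Sum>f\<in>?C. real d * real (card (full_cycle_words {0..<d} f t)))"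
    by (simp add: hurwitz_count_eq_sum sum_distrib_left d_def t_def)
  also have "\<dots> = (\<Sum>f\<in>?C. real d ^ t * fact t * (real (prod_list \<beta>) * ?c))"
    using card_full_cycle_words[of _ "{0..<d}" t] cycle_series_nth[of "mset \<beta>" "2 * g"] d_pos assms(2)
    by (intro sum.cong refl) (simp add: cycle_class_def prod_mset_prod_list t_eqs(3))
  finally have "real d * (real (aut \<beta>) * real (hurwitz_count g \<beta>))
      = real (card ?C * prod_list \<beta> * aut \<beta>) * (real d ^ t * fact t * ?c)"
    by (simp add: mult_ac)
  also have "card ?C * prod_list \<beta> * aut \<beta> = fact (card {0..<d})"
    by (rule card_cycle_class) (use assms(3) d_def in auto)
  finally have "real d * H_dd g \<beta> = real d ^ t * fact t * ?c"
    by (simp add: H_dd_def flip: d_def)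
  also have "real d ^ t = real d * (real d * real d ^ (2 * g + length \<beta> - 3))"
    unfolding t_eqs(2) power_add power2_eq_square by (rule mult.assoc)
  finally have "H_dd g \<beta> = real d * real d ^ (2 * g + length \<beta> - 3) * fact t * ?c"
    using d_pos by simp
  then show ?thesis using d_pos unfolding t_eqs(1)[symmetric] d_def[symmetric] by simp
qed

section \<open>Bernoulli numbers\<close>

definition bernoulli_fps :: "real fps" where
  "bernoulli_fps = fps_X / (fps_exp 1 - 1)"

lemma bernoulli_fps_nth: "fps_nth bernoulli_fps r = bernoulli_num r / fact r"
  by (simp add: bernoulli_num_def bernoulli_fps_def)

lemma bernoulli_fps_mult: "bernoulli_fps * (fps_exp 1 - 1) = fps_X"
proof -
  have "subdegree (fps_exp 1 - 1 :: real fps) = 1" by (rule subdegreeI) auto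
  moreover have "fps_exp 1 - 1 \<noteq> (0 :: real fps)" by simp
  ultimately have "(fps_exp 1 - 1 :: real fps) dvd fps_X" by (simp add: fps_dvd_iff)
  then show ?thesis unfolding bernoulli_fps_def by (rule dvd_div_mult_self)
qed

lemma exp_half_squared: "fps_exp (1 / 2 :: real) * fps_exp (1 / 2) = fps_exp 1"
  by (simp flip: fps_exp_add_mult)

lemma inverse_sinhc_eq_bernoulli: "inverse (sinhc_fps 1) = fps_exp (1 / 2) * bernoulli_fps"
proof -
  have "fps_X * (sinhc_fps 1 * (fps_exp (1 / 2) * bernoulli_fps))
      = sinh_fps 1 * fps_exp (1 / 2) * bernoulli_fps"
    by (simp add: sinh_fps_eq_sinhc mult_ac)
  also have "sinh_fps 1 * fps_exp (1 / 2) = fps_exp 1 - 1"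
    unfolding sinh_fps_def left_diff_distrib by (simp flip: fps_exp_add_mult)
  also have "\<dots> * bernoulli_fps = fps_X * 1" using bernoulli_fps_mult by (simp add: mult_ac)
  finally have "sinhc_fps 1 * (fps_exp (1 / 2) * bernoulli_fps) = 1"
    by (subst (asm) mult_cancel_left) auto
  then show ?thesis by (rule fps_inverse_unique)
qed

text \<open>The identity \<open>x / (2 sinh (x/2)) = 2 f(x/2) - f(x)\<close> for \<open>f(x) = x / (e\<^sup>x - 1)\<close>, read off
  coefficientwise.\<close>

lemma inverse_sinhc_nth: "fps_nth (inverse (sinhc_fps 1)) k = (2 / 2 ^ k - 1) * fps_nth bernoulli_fps k"
proof -
  define f where "f = bernoulli_fps oo (fps_const (1 / 2) * fps_X)"
  let ?e = "fps_exp (1 / 2) :: real fps"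
  have "(bernoulli_fps * (fps_exp 1 - 1)) oo (fps_const (1 / 2) * fps_X) = f * (?e - 1)"
    by (simp add: f_def fps_compose_mult_distrib fps_compose_sub_distrib)
  then have "f * (?e - 1) = fps_const (1 / 2) * fps_X"
    by (simp add: bernoulli_fps_mult)
  then have half: "2 * (f * (?e - 1)) = fps_X"
    by (simp add: numeral_fps_const flip: mult.assoc)
  have "(2 * f - bernoulli_fps) * (fps_exp 1 - 1)
      = 2 * (f * (?e - 1)) * (?e + 1) - bernoulli_fps * (fps_exp 1 - 1)"
    by (simp add: algebra_simps flip: exp_half_squared)
  also have "\<dots> = ?e * fps_X" unfolding half bernoulli_fps_mult by (simp add: algebra_simps)
  also have "\<dots> = inverse (sinhc_fps 1) * (fps_exp 1 - 1)"
    unfolding inverse_sinhc_eq_bernoulli mult.assoc bernoulli_fps_mult ..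
  finally have "2 * f - bernoulli_fps = inverse (sinhc_fps 1)"
    by (subst (asm) mult_cancel_right) auto
  moreover have "fps_nth (2 * f - bernoulli_fps) k = (2 / 2 ^ k - 1) * fps_nth bernoulli_fps k"
    by (simp add: f_def numeral_fps_const fps_compose_linear power_divide left_diff_distrib)
  ultimately show ?thesis by simp
qed

text \<open>The series \<open>h = (x/2) coth (x/2)\<close> agrees with \<open>x / (e\<^sup>x - 1)\<close> up to \<open>x/2\<close>. It satisfies
  \<open>x h' = h - h\<^sup>2 + x\<^sup>2/4\<close>, a recurrence from which the signs of its coefficients can be read off.\<close>

definition half_coth_fps :: "real fps" where
  "half_coth_fps = fps_const (1 / 2) * cosh_fps 1 * inverse (sinhc_fps 1)"

lemma half_coth_fps_eq_bernoulli: "half_coth_fps = bernoulli_fps + fps_const (1 / 2) * fps_X"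
proof -
  have exp: "cosh_fps 1 * fps_exp (1 / 2) = (fps_exp 1 - 1) + (2 :: real fps)"
    unfolding cosh_fps_def distrib_right by (simp flip: fps_exp_add_mult)
  have "half_coth_fps = fps_const (1 / 2) * (bernoulli_fps * (cosh_fps 1 * fps_exp (1 / 2)))"
    by (simp add: half_coth_fps_def inverse_sinhc_eq_bernoulli mult_ac)
  also have "\<dots> = fps_const (1 / 2) * fps_X + fps_const (1 / 2) * (2 * bernoulli_fps)"
    unfolding exp distrib_left bernoulli_fps_mult by (simp add: mult.commute)
  finally show ?thesis by (simp add: numeral_fps_const add.commute flip: mult.assoc)
qed

lemma half_coth_fps_ode:
  "4 * (fps_X * fps_deriv half_coth_fps) = 4 * half_coth_fps - 4 * half_coth_fps\<^sup>2 + fps_X\<^sup>2"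
proof -
  let ?h = half_coth_fps and ?S = "sinhc_fps 1 :: real fps" and ?C = "cosh_fps 1 :: real fps"
  have sinh: "sinh_fps 1 = fps_X * ?S" by (simp add: sinh_fps_eq_sinhc)
  have "?h * ?S = fps_const (1 / 2) * ?C"
    by (simp add: half_coth_fps_def mult.assoc inverse_mult_eq_1)
  then have cosh: "?C = 2 * ?h * ?S" by (simp add: numeral_fps_const mult.assoc)
  have "2 * (?S + fps_X * fps_deriv ?S) = ?C"
    using sinh_fps_deriv[of "1 :: real"] by (simp add: sinh algebra_simps)
  then have "?S + fps_X * fps_deriv ?S = ?h * ?S"
    unfolding cosh mult.assoc by (subst (asm) mult_cancel_left) simp
  then have S_deriv: "fps_X * fps_deriv ?S = ?h * ?S - ?S" by (simp add: eq_diff_eq add.commute)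
  have "4 * (fps_deriv ?h * ?S + ?h * fps_deriv ?S) = 2 * fps_deriv ?C"
    unfolding cosh by (simp add: algebra_simps)
  also have "\<dots> = fps_X * ?S" using cosh_fps_deriv[of "1 :: real"] by (simp add: sinh)
  finally have "fps_X * (4 * (fps_deriv ?h * ?S + ?h * fps_deriv ?S)) = fps_X * (fps_X * ?S)"
    by simp
  then have "4 * (fps_X * fps_deriv ?h) * ?S + 4 * ?h * (fps_X * fps_deriv ?S) = fps_X\<^sup>2 * ?S"
    by (simp add: algebra_simps power2_eq_square)
  then have "4 * (fps_X * fps_deriv ?h) * ?S = (4 * ?h - 4 * ?h\<^sup>2 + fps_X\<^sup>2) * ?S"
    unfolding S_deriv by (simp add: algebra_simps power2_eq_square)
  then show ?thesis by simp
qed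

lemma half_coth_fps_recurrence:
  assumes "k \<ge> 1"
  shows "(real k + 1) * fps_nth half_coth_fps k = (if k = 2 then 1 / 4 else 0)
    - (\<Sum>i\<in>{1..<k}. fps_nth half_coth_fps i * fps_nth half_coth_fps (k - i))"
proof -
  let ?h = "fps_nth half_coth_fps"
  have nth_0: "?h 0 = 1" by (simp add: half_coth_fps_def cosh_fps_def)
  have "fps_nth (half_coth_fps\<^sup>2) k = (\<Sum>i\<in>{0..k}. ?h i * ?h (k - i))"
    by (simp add: power2_eq_square fps_mult_nth)
  also have "{0..k} = insert 0 (insert k {1..<k})" using assms by auto
  also have "(\<Sum>i\<in>\<dots>. ?h i * ?h (k - i)) = 2 * ?h k + (\<Sum>i\<in>{1..<k}. ?h i * ?h (k - i))"
    using assms nth_0 by simp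
  finally have square: "fps_nth (half_coth_fps\<^sup>2) k = 2 * ?h k + (\<Sum>i\<in>{1..<k}. ?h i * ?h (k - i))" .
  have "4 * (real k * ?h k) = fps_nth (4 * (fps_X * fps_deriv half_coth_fps)) k"
    using assms by (cases k) (auto simp: numeral_fps_const)
  also have "\<dots> = 4 * (?h k - fps_nth (half_coth_fps\<^sup>2) k + (if k = 2 then 1 / 4 else 0))"
    unfolding half_coth_fps_ode by (simp add: numeral_fps_const fps_X_power_iff)
  finally have "real k * ?h k = ?h k - fps_nth (half_coth_fps\<^sup>2) k + (if k = 2 then 1 / 4 else 0)"
    by simp
  then show ?thesis unfolding square by (simp add: algebra_simps)
qed

lemma half_coth_fps_nth_odd:
  assumes "odd k"
  shows "fps_nth half_coth_fps k = 0"
  using assms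
proof (induction k rule: less_induct)
  case (less k)
  have "(\<Sum>i\<in>{1..<k}. fps_nth half_coth_fps i * fps_nth half_coth_fps (k - i)) = 0"
  proof (rule sum.neutral, rule ballI)
    fix i assume i_in: "i \<in> {1..<k}"
    then have "odd i \<or> odd (k - i)" using less.prems by auto
    then show "fps_nth half_coth_fps i * fps_nth half_coth_fps (k - i) = 0"
      using less.IH[of i] less.IH[of "k - i"] i_in by auto
  qed
  moreover have "k \<ge> 1" "k \<noteq> 2" using less.prems by (auto elim: oddE)
  ultimately have "(real k + 1) * fps_nth half_coth_fps k = 0"
    using half_coth_fps_recurrence[of k] by simp
  then show ?case by simp
qed

lemma half_coth_fps_even_recurrence:
  assumes "j \<ge> 1"
  shows "(2 * real j + 1) * fps_nth half_coth_fps (2 * j) = (if j = 1 then 1 / 4 else 0)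
    - (\<Sum>i\<in>{1..<j}. fps_nth half_coth_fps (2 * i) * fps_nth half_coth_fps (2 * (j - i)))"
proof -
  let ?h = "fps_nth half_coth_fps"
  have "(\<Sum>i\<in>{1..<2 * j}. ?h i * ?h (2 * j - i)) = (\<Sum>i\<in>(\<lambda>i. 2 * i) ` {1..<j}. ?h i * ?h (2 * j - i))"
  proof (rule sum.mono_neutral_right)
    show "\<forall>i\<in>{1..<2 * j} - (\<lambda>i. 2 * i) ` {1..<j}. ?h i * ?h (2 * j - i) = 0"
    proof
      fix i assume "i \<in> {1..<2 * j} - (\<lambda>i. 2 * i) ` {1..<j}"
      then have "odd i" by (auto elim!: evenE)
      then show "?h i * ?h (2 * j - i) = 0" by (simp add: half_coth_fps_nth_odd)
    qed
  qed auto
  also have "\<dots> = (\<Sum>i\<in>{1..<j}. ?h (2 * i) * ?h (2 * (j - i)))"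
    by (simp add: sum.reindex inj_on_def diff_mult_distrib2)
  finally show ?thesis
    using half_coth_fps_recurrence[of "2 * j"] assms by auto
qed

lemma half_coth_fps_even_sign:
  assumes "j \<ge> 1"
  shows "(-1) ^ j * fps_nth half_coth_fps (2 * j) < 0"
  using assms
proof (induction j rule: less_induct)
  case (less j)
  let ?h = "\<lambda>i. fps_nth half_coth_fps (2 * i)"
  note recurrence = half_coth_fps_even_recurrence[OF less.prems]
  show ?case
  proof (cases "j = 1")
    case True
    then show ?thesis using recurrence by simp
  next
    case False
    have "(2 * real j + 1) * ((-1) ^ j * ?h j) = (-1) ^ j * ((2 * real j + 1) * ?h j)"
      by simp
    also have "\<dots> = - (\<Sum>i\<in>{1..<j}. (-1) ^ j * (?h i * ?h (j - i)))"
      unfolding recurrence using False by (simp add: sum_distrib_left)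
    also have "\<dots> = - (\<Sum>i\<in>{1..<j}. ((-1) ^ i * ?h i) * ((-1) ^ (j - i) * ?h (j - i)))"
    proof (intro arg_cong[of _ _ uminus] sum.cong refl)
      fix i assume "i \<in> {1..<j}"
      then have "(-1 :: real) ^ j = (-1) ^ i * (-1) ^ (j - i)" by (simp flip: power_add)
      then show "(-1) ^ j * (?h i * ?h (j - i)) = ((-1) ^ i * ?h i) * ((-1) ^ (j - i) * ?h (j - i))"
        by simp
    qed
    also have "\<dots> < 0"
      using less.IH less.prems False by (simp, intro sum_pos mult_neg_neg) auto
    finally show ?thesis by (simp add: mult_less_0_iff)
  qed
qed

lemma inverse_sinhc_even_nonzero:
  assumes "j \<ge> 1"
  shows "fps_nth (inverse (sinhc_fps 1 :: real fps)) (2 * j) \<noteq> 0"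
proof -
  have "fps_nth bernoulli_fps (2 * j) = fps_nth half_coth_fps (2 * j)"
    using assms by (simp add: half_coth_fps_eq_bernoulli)
  also have "\<dots> \<noteq> 0" using half_coth_fps_even_sign[OF assms] by auto
  finally have "fps_nth bernoulli_fps (2 * j) \<noteq> 0" .
  moreover have "(2::real) < 2 ^ (2 * j)"
    using assms power_strict_increasing[of 1 "2 * j" "2::real"] by simp
  ultimately show ?thesis by (simp add: inverse_sinhc_nth)
qed

section \<open>Central differences of powers\<close>

definition central_diff_poly :: "nat \<Rightarrow> real poly" where
  "central_diff_poly b = smult (1 / fact (b + 1)) ([:1, 1:] ^ (b + 1) - [:-1, 1:] ^ (b + 1))"

lemma coeff_central_diff_poly:
  "coeff (central_diff_poly b) j = (if j \<le> b \<and> even (b - j) then 2 / (fact j * fact (b - j + 1)) else 0)"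
proof (cases "j \<le> b")
  case True
  then have "coeff (central_diff_poly b) j
      = real (Suc b choose j) * (1 - (-1) ^ Suc (b - j)) / fact (Suc b)"
    by (simp add: central_diff_poly_def coeff_linear_poly_power Suc_diff_le right_diff_distrib
        diff_divide_distrib del: binomial_Suc_Suc power_Suc fact_Suc)
  also have "real (Suc b choose j) = fact (Suc b) / (fact j * fact (Suc (b - j)))"
    using True by (simp add: binomial_fact Suc_diff_le del: fact_Suc)
  finally show ?thesis using True by (simp del: fact_Suc)
next
  case False
  have "coeff ([:c, 1:] ^ (b + 1)) j = (if j = b + 1 then 1 else 0)" for c :: real
  proof (cases "j = b + 1")
    case j: False
    then show ?thesis using False degree_linear_power[of c "b + 1"] by (intro trans[OF coeff_eq_0]) auto
  qed (simp add: coeff_linear_power del: power_Suc)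
  then show ?thesis using False by (simp add: central_diff_poly_def del: power_Suc)
qed

lemma degree_central_diff_poly: "degree (central_diff_poly b) = b"
proof (rule antisym)
  show "degree (central_diff_poly b) \<le> b" by (rule degree_le) (simp add: coeff_central_diff_poly)
  show "b \<le> degree (central_diff_poly b)" by (rule le_degree) (simp add: coeff_central_diff_poly)
qed

lemma central_diff_poly_nonzero: "central_diff_poly b \<noteq> 0"
proof
  assume "central_diff_poly b = 0"
  then have "coeff (central_diff_poly b) b = 0" by simp
  then show False by (simp add: coeff_central_diff_poly)
qed

lemma degree_prod_central_diff_poly:
  "length e = n \<Longrightarrow> degree (\<Prod>i<n. central_diff_poly (e ! i)) = sum_list e"
  by (simp add: degree_prod_eq_sum_degree central_diff_poly_nonzero degree_central_diff_poly
      sum_list_sum_nth atLeast0LessThan)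

lemma poly_central_diff_poly:
  "poly (central_diff_poly b) x = ((x + 1) ^ (b + 1) - (x - 1) ^ (b + 1)) / fact (b + 1)"
  by (simp add: central_diff_poly_def add.commute del: power_Suc fact_Suc)

lemma central_diff_poly_generating_function:
  assumes "a \<noteq> 0"
  shows "Abs_fps (\<lambda>b. (a / 2) ^ b * poly (central_diff_poly b) x) = 2 * fps_exp (a * x / 2) * sinhc_fps a"
    (is "?L = _")
proof -
  have "fps_const a * fps_X * ?L = 2 * (fps_exp (a / 2 * (x + 1)) - fps_exp (a / 2 * (x - 1)))"
  proof (rule fps_ext)
    fix k show "fps_nth (fps_const a * fps_X * ?L) k
      = fps_nth (2 * (fps_exp (a / 2 * (x + 1)) - fps_exp (a / 2 * (x - 1)))) k"
    proof (cases k)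
      case (Suc b)
      have "fps_nth (fps_const a * fps_X * ?L) (Suc b)
          = a * (a / 2) ^ b * ((x + 1) ^ Suc b - (x - 1) ^ Suc b) / fact (Suc b)"
        by (simp add: mult.assoc poly_central_diff_poly del: power_Suc fact_Suc)
      also have "\<dots> = 2 * ((a / 2 * (x + 1)) ^ Suc b - (a / 2 * (x - 1)) ^ Suc b) / fact (Suc b)"
        unfolding power_mult_distrib right_diff_distrib[symmetric] power_Suc[of "a / 2"] by simp
      also have "\<dots> = fps_nth (2 * (fps_exp (a / 2 * (x + 1)) - fps_exp (a / 2 * (x - 1)))) (Suc b)"
        by (simp add: numeral_fps_const diff_divide_distrib right_diff_distrib del: power_Suc fact_Suc)
      finally show ?thesis by (simp only: Suc)
    qed (simp add: mult.assoc)
  qed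
  also have "\<dots> = 2 * (fps_exp (a * x / 2) * sinh_fps a)"
    by (simp add: sinh_fps_def algebra_simps add_divide_distrib diff_divide_distrib
        flip: fps_exp_add_mult)
  also have "\<dots> = fps_const a * fps_X * (2 * fps_exp (a * x / 2) * sinhc_fps a)"
    by (simp add: sinh_fps_eq_sinhc mult_ac)
  finally show ?thesis using assms by (subst (asm) mult_cancel_left) auto
qed

lemma fps_prod_lessThan_nth:
  fixes F :: "nat \<Rightarrow> 'a :: comm_ring_1 fps"
  shows "fps_nth (\<Prod>i<n. F i) s = (\<Sum>e\<in>natpermute s n. \<Prod>i<n. fps_nth (F i) (e ! i))"
proof (cases n)
  case 0
  then show ?thesis by (simp add: natpermute_0)
next
  case (Suc m)
  then have "{..<n} = {0..m}" by auto
  then show ?thesis using fps_prod_nth[of F m s] Suc by simp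
qed

lemma sum_natpermute_central_diff_poly:
  assumes "length \<beta> = n" "\<forall>m\<in>set \<beta>. m > 0"
  shows "(\<Sum>e\<in>natpermute s n. smult (\<Prod>i<n. (real (\<beta> ! i) / 2) ^ (e ! i)) (\<Prod>i<n. central_diff_poly (e ! i)))
    = (\<Sum>k\<le>s. monom (2 ^ n * ((real (sum_list \<beta>) / 2) ^ k / fact k
        * fps_nth (\<Prod>i<n. sinhc_fps (real (\<beta> ! i))) (s - k))) k)" (is "?L = ?R")
proof -
  let ?P = "\<Prod>i<n. sinhc_fps (real (\<beta> ! i))" and ?d = "real (sum_list \<beta>)"
  have "poly ?L x = poly ?R x" for x
  proof -
    define F where "F i = Abs_fps (\<lambda>b. (real (\<beta> ! i) / 2) ^ b * poly (central_diff_poly b) x)" for i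
    have exps: "(\<Prod>i<n. fps_exp (real (\<beta> ! i) * x / 2)) = fps_exp (?d * x / 2)"
    proof -
      have "(\<Prod>i<n. fps_exp (real (\<beta> ! i) * x / 2)) = fps_exp (\<Sum>i<n. real (\<beta> ! i) * x / 2)"
        by (induction n) (simp_all add: fps_exp_add_mult)
      also have "(\<Sum>i<n. real (\<beta> ! i) * x / 2) = ?d * x / 2"
        using assms(1)
        by (simp add: sum_list_sum_nth atLeast0LessThan flip: sum_distrib_right sum_divide_distrib)
      finally show ?thesis .
    qed
    have "poly ?L x = (\<Sum>e\<in>natpermute s n. \<Prod>i<n. fps_nth (F i) (e ! i))"
      by (simp add: poly_sum poly_prod F_def prod.distrib)
    also have "\<dots> = fps_nth (\<Prod>i<n. F i) s" by (rule fps_prod_lessThan_nth[symmetric])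
    also have "(\<Prod>i<n. F i) = (\<Prod>i<n. 2 * fps_exp (real (\<beta> ! i) * x / 2) * sinhc_fps (real (\<beta> ! i)))"
      unfolding F_def using assms by (intro prod.cong refl central_diff_poly_generating_function) auto
    also have "\<dots> = fps_const (2 ^ n) * (fps_exp (?d * x / 2) * ?P)"
      by (simp add: prod.distrib exps numeral_fps_const fps_const_power mult.assoc)
    also have "fps_nth \<dots> s = 2 ^ n * (\<Sum>k\<le>s. (?d * x / 2) ^ k / fact k * fps_nth ?P (s - k))"
      by (simp add: fps_mult_nth[of "fps_exp _"] atLeast0AtMost)
    also have "\<dots> = poly ?R x"
      by (simp add: poly_sum poly_monom sum_distrib_left power_mult_distrib power_divide mult_ac)
    finally show ?thesis .
  qed
  then show ?thesis by (simp flip: poly_eq_poly_eq_iff add: fun_eq_iff)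
qed

lemma sum_natpermute_coeff_central_diff_poly:
  assumes "length \<beta> = n" "\<forall>m\<in>set \<beta>. m > 0" "N \<le> s"
  shows "(\<Sum>e\<in>natpermute s n. coeff (\<Prod>i<n. central_diff_poly (e ! i)) N * (\<Prod>i<n. real (\<beta> ! i) ^ (e ! i)))
    = 2 ^ (s + n) / (2 ^ N * fact N) * (real (sum_list \<beta>) ^ N
        * fps_nth (\<Prod>i<n. sinhc_fps (real (\<beta> ! i))) (s - N))"
proof -
  let ?P = "\<Prod>i<n. sinhc_fps (real (\<beta> ! i))" and ?d = "real (sum_list \<beta>)"
  have monomial: "(\<Prod>i<n. real (\<beta> ! i) ^ (e ! i)) = 2 ^ s * (\<Prod>i<n. (real (\<beta> ! i) / 2) ^ (e ! i))"
    if "e \<in> natpermute s n" for e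
  proof -
    have "(\<Sum>i<n. e ! i) = s" using that by (auto simp: natpermute_def sum_list_sum_nth atLeast0LessThan)
    then show ?thesis by (simp add: power_divide prod_dividef flip: power_sum)
  qed
  have "(\<Sum>e\<in>natpermute s n. coeff (\<Prod>i<n. central_diff_poly (e ! i)) N * (\<Prod>i<n. real (\<beta> ! i) ^ (e ! i)))
      = 2 ^ s * coeff (\<Sum>e\<in>natpermute s n.
          smult (\<Prod>i<n. (real (\<beta> ! i) / 2) ^ (e ! i)) (\<Prod>i<n. central_diff_poly (e ! i))) N"
    by (simp add: coeff_sum sum_distrib_left monomial mult_ac)
  also have "\<dots> = 2 ^ s * (2 ^ n * ((?d / 2) ^ N / fact N * fps_nth ?P (s - N)))"
    unfolding sum_natpermute_central_diff_poly[OF assms(1,2)] using assms(3) by (simp add: coeff_sum)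
  finally show ?thesis by (simp add: power_add power_divide)
qed

section \<open>The polynomial and its coefficients\<close>

text \<open>The coefficients of \<open>(\<beta>\<^sub>1 + \<dots> + \<beta>\<^sub>n)\<^sup>N \<cdot> [x\<^sup>K] (\<Prod>\<^sub>i S(\<beta>\<^sub>i x)) U(x)\<close> as a polynomial
  in \<open>\<beta>\<^sub>1, \<dots>, \<beta>\<^sub>n\<close>.\<close>

definition sinhc_prod_coeffs :: "real fps \<Rightarrow> nat \<Rightarrow> nat \<Rightarrow> nat \<Rightarrow> nat list \<Rightarrow> real" where
  "sinhc_prod_coeffs U N K n e =
     (if length e = n \<and> sum_list e \<le> N + K
      then fps_nth U (N + K - sum_list e) * (2 ^ N * fact N / 2 ^ (sum_list e + n))
        * coeff (\<Prod>i<n. central_diff_poly (e ! i)) N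
      else 0)"

lemma sinhc_prod_coeffs_nonzeroD:
  assumes "sinhc_prod_coeffs U N K n e \<noteq> 0"
  shows "length e = n" "N \<le> sum_list e" "sum_list e \<le> N + K"
proof -
  show length: "length e = n" and "sum_list e \<le> N + K"
    using assms by (auto simp: sinhc_prod_coeffs_def split: if_splits)
  show "N \<le> sum_list e"
  proof (rule ccontr)
    assume "\<not> N \<le> sum_list e"
    then have "coeff (\<Prod>i<n. central_diff_poly (e ! i)) N = 0"
      by (intro coeff_eq_0) (simp add: degree_prod_central_diff_poly[OF length])
    then show False using assms by (simp add: sinhc_prod_coeffs_def split: if_splits)
  qed
qed

lemma sinhc_prod_coeffs_support:
  "{e. sinhc_prod_coeffs U N K n e \<noteq> 0} \<subseteq> (\<Union>s\<in>{N..N + K}. natpermute s n)"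
  using sinhc_prod_coeffs_nonzeroD[of U N K n] by (auto simp: natpermute_def)

lemma is_poly_sinhc_prod_coeffs: "is_poly_coeffs n (sinhc_prod_coeffs U N K n)"
  unfolding is_poly_coeffs_def
  using finite_subset[OF sinhc_prod_coeffs_support] sinhc_prod_coeffs_nonzeroD(1)
  by (auto simp: natpermute_finite)

lemma prod_nth_eq_prod_mset:
  assumes "length xs = n"
  shows "(\<Prod>i<n. f (xs ! i)) = (\<Prod>x\<in>#mset xs. f x)"
proof -
  have "(\<Prod>x\<in>#mset xs. f x) = prod_list (map f xs)"
    by (simp add: prod_mset_prod_list flip: mset_map)
  then show ?thesis using assms by (simp add: prod.list_conv_set_nth atLeast0LessThan)
qed

lemma symmetric_sinhc_prod_coeffs: "symmetric_coeffs n (sinhc_prod_coeffs U N K n)"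
  unfolding symmetric_coeffs_def
proof (intro allI impI)
  fix p and e :: "nat list" assume "p permutes {..<n} \<and> length e = n"
  then have p_perm: "p permutes {..<length e}" "length e = n" by auto
  have perm: "mset (permute_list p e) = mset e" using mset_permute_list[OF p_perm(1)] .
  then have "sum_list (permute_list p e) = sum_list e" by (metis sum_mset_sum_list)
  then show "sinhc_prod_coeffs U N K n (permute_list p e) = sinhc_prod_coeffs U N K n e"
    using p_perm(2) perm by (simp add: sinhc_prod_coeffs_def prod_nth_eq_prod_mset)
qed

theorem poly_eval_sinhc_prod_coeffs:
  assumes "length \<beta> = n" "\<forall>m\<in>set \<beta>. m > 0"
  shows "poly_eval (sinhc_prod_coeffs U N K n) \<beta>
    = real (sum_list \<beta>) ^ N * fps_nth ((\<Prod>m\<in>#mset \<beta>. sinhc_fps (real m)) * U) K"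
proof -
  let ?c = "sinhc_prod_coeffs U N K n" and ?m = "\<lambda>e. \<Prod>i<n. real (\<beta> ! i) ^ (e ! i)"
  let ?P = "\<Prod>i<n. sinhc_fps (real (\<beta> ! i))" and ?d = "real (sum_list \<beta>)"
  have homogeneous: "(\<Sum>e\<in>natpermute (N + r) n. ?c e * ?m e) = ?d ^ N * (fps_nth ?P r * fps_nth U (K - r))"
    if "r \<le> K" for r
  proof -
    have "(\<Sum>e\<in>natpermute (N + r) n. ?c e * ?m e)
        = (\<Sum>e\<in>natpermute (N + r) n. fps_nth U (K - r) * (2 ^ N * fact N / 2 ^ (N + r + n))
            * (coeff (\<Prod>i<n. central_diff_poly (e ! i)) N * ?m e))"
      using that by (intro sum.cong refl) (simp add: natpermute_def sinhc_prod_coeffs_def)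
    then show ?thesis
      unfolding sum_distrib_left[symmetric]
      using sum_natpermute_coeff_central_diff_poly[OF assms, of N "N + r"]
      by simp
  qed
  have "poly_eval ?c \<beta> = (\<Sum>e\<in>(\<Union>s\<in>{N..N + K}. natpermute s n). ?c e * ?m e)"
    unfolding poly_eval_def assms(1) using sinhc_prod_coeffs_support
    by (intro sum.mono_neutral_left) (auto simp: natpermute_finite)
  also have "\<dots> = (\<Sum>s\<in>{N..N + K}. \<Sum>e\<in>natpermute s n. ?c e * ?m e)"
    by (intro sum.UNION_disjoint ballI natpermute_finite) (auto simp: natpermute_def)
  also have "\<dots> = (\<Sum>r\<in>{0..K}. \<Sum>e\<in>natpermute (N + r) n. ?c e * ?m e)"
    using sum.shift_bounds_cl_nat_ivl[of "\<lambda>s. \<Sum>e\<in>natpermute s n. ?c e * ?m e" 0 N K]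
    by (simp add: add.commute)
  also have "\<dots> = ?d ^ N * fps_nth (?P * U) K"
    by (simp add: homogeneous fps_mult_nth sum_distrib_left)
  finally show ?thesis
    by (simp add: prod_nth_eq_prod_mset[OF assms(1), of "\<lambda>m. sinhc_fps (real m)"])
qed

lemma sinhc_prod_coeffs_degree_attained:
  assumes "n \<ge> 1" "even r" "r \<le> K" "fps_nth U (K - r) \<noteq> 0"
  shows "\<exists>e. sinhc_prod_coeffs U N K n e \<noteq> 0 \<and> sum_list e = N + r"
proof (intro exI conjI)
  let ?e = "(N + r) # replicate (n - 1) 0"
  have length: "length ?e = n" using assms(1) by simp
  show degree: "sum_list ?e = N + r" by (simp add: sum_list_replicate)
  have "central_diff_poly 0 = [:2:]" by (simp add: central_diff_poly_def)
  then have "(\<Prod>i<n. central_diff_poly (?e ! i)) = smult (2 ^ (n - 1)) (central_diff_poly (N + r))"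
    unfolding prod_nth_eq_prod_mset[OF length] by (simp add: poly_const_pow)
  then have "coeff (\<Prod>i<n. central_diff_poly (?e ! i)) N \<noteq> 0"
    using assms(2) by (simp add: coeff_central_diff_poly del: fact_Suc)
  then show "sinhc_prod_coeffs U N K n ?e \<noteq> 0"
    using assms(3,4) unfolding sinhc_prod_coeffs_def degree using length by simp
qed

lemma coeff_prod_central_diff_poly_top:
  assumes "length e = n"
  shows "coeff (\<Prod>i<n. central_diff_poly (e ! i)) (sum_list e) = 2 ^ n / (\<Prod>i<n. fact (e ! i))"
proof -
  have "coeff (\<Prod>i<n. central_diff_poly (e ! i)) (sum_list e)
      = (\<Prod>i<n. coeff (central_diff_poly (e ! i)) (e ! i))"
    using lead_coeff_prod[of "\<lambda>i. central_diff_poly (e ! i)" "{..<n}"]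
      degree_prod_central_diff_poly[OF assms]
    by (simp add: degree_central_diff_poly)
  then show ?thesis by (simp add: coeff_central_diff_poly prod_dividef)
qed

definition hurwitz_coeff :: "nat \<Rightarrow> nat \<Rightarrow> nat list \<Rightarrow> real" where
  "hurwitz_coeff g n = sinhc_prod_coeffs (inverse (sinhc_fps 1)) (2 * g + n - 3) (2 * g) n"

lemma H_dd_eq_poly_eval_hurwitz_coeff:
  assumes "g \<ge> 1" "n \<ge> 1" "length \<beta> = n" "\<forall>m\<in>set \<beta>. m > 0"
  shows "H_dd g \<beta> / (fact (2 * g + n - 1) * real (sum_list \<beta>)) = poly_eval (hurwitz_coeff g n) \<beta>"
proof -
  have "\<beta> \<noteq> []" using assms(2,3) by auto
  then show ?thesis
    using one_part_double_hurwitz[OF assms(1) _ assms(4)] poly_eval_sinhc_prod_coeffs[OF assms(3,4)]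
    by (simp add: assms(3) hurwitz_coeff_def sinhc_ratio_def)
qed

lemma hurwitz_coeff_degree_bounds:
  assumes "g \<ge> 1" "n \<ge> 1" "hurwitz_coeff g n e \<noteq> 0"
  shows "sum_list e \<le> 4 * g + n - 3" "2 * g + n - 3 \<le> sum_list e"
  using sinhc_prod_coeffs_nonzeroD[OF assms(3)[unfolded hurwitz_coeff_def]] assms(1,2) by auto

lemma hurwitz_coeff_attains_highest_degree:
  assumes "g \<ge> 1" "n \<ge> 1"
  shows "\<exists>e. hurwitz_coeff g n e \<noteq> 0 \<and> sum_list e = 4 * g + n - 3"
proof -
  have "2 * g + n - 3 + 2 * g = 4 * g + n - 3" using assms by auto
  then show ?thesis
    using sinhc_prod_coeffs_degree_attained[OF assms(2), of "2 * g" "2 * g" "inverse (sinhc_fps 1)"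
        "2 * g + n - 3"]
    by (simp add: hurwitz_coeff_def)
qed

lemma hurwitz_coeff_attains_lowest_degree:
  assumes "g \<ge> 1" "n \<ge> 1"
  shows "\<exists>e. hurwitz_coeff g n e \<noteq> 0 \<and> sum_list e = 2 * g + n - 3"
  using sinhc_prod_coeffs_degree_attained[OF assms(2), of 0 "2 * g" "inverse (sinhc_fps 1)" "2 * g + n - 3"]
    inverse_sinhc_even_nonzero[OF assms(1)]
  by (simp add: hurwitz_coeff_def)

lemma C_const_eq_inverse_sinhc_nth:
  assumes "K + 2 * k = 2 * g + n" "int b + 3 - 2 * int g = int K"
  shows "C_const b g n = fps_nth (inverse (sinhc_fps 1)) (2 * k) / (fact K * 2 ^ K)"
proof -
  define T where "T i = inv_fact (int i + 2 * int g - int b - 3) * bernoulli_num (2 * g + n - i)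
      / (fact (2 * g + n - i) * 2 ^ i)" for i
  have below: "T i = 0" if "i < K" for i
    using that assms(2) by (simp add: T_def inv_fact_def)
  have above: "T (j + K) = (1 / 2) ^ j / fact j * fps_nth bernoulli_fps (2 * k - j) / 2 ^ K" for j
  proof -
    have args: "int (j + K) + 2 * int g - int b - 3 = int j" "2 * g + n - (j + K) = 2 * k - j"
      using assms by auto
    then show ?thesis
      unfolding T_def args by (simp add: inv_fact_def bernoulli_fps_nth power_add power_divide)
  qed
  have "(\<Sum>i=0..2 * g + n. T i) = (\<Sum>i=0 + K..2 * k + K. T i)"
    using below assms(1) by (intro sum.mono_neutral_right) auto
  also have "\<dots> = (\<Sum>j=0..2 * k. T (j + K))" by (rule sum.shift_bounds_cl_nat_ivl)
  also have "\<dots> = fps_nth (inverse (sinhc_fps 1)) (2 * k) / 2 ^ K"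
    unfolding inverse_sinhc_eq_bernoulli by (simp add: above fps_mult_nth sum_divide_distrib)
  finally have "(\<Sum>i=0..2 * g + n. T i) = fps_nth (inverse (sinhc_fps 1)) (2 * k) / 2 ^ K" .
  then show ?thesis
    unfolding C_const_def assms(2) T_def[symmetric] by (simp add: inv_fact_def mult.commute)
qed

lemma Chat_eq_coeff:
  assumes "length bs = n" "int (sum_list bs) + 3 - 2 * int g = int K"
  shows "Chat g bs
    = fact (2 * g + n - 3) * fact K * coeff (\<Prod>i<n. central_diff_poly (bs ! i)) (2 * g + n - 3)"
  using assms by (simp add: Chat_def central_diff_poly_def Let_def)

lemma hurwitz_coeff_eq_C_const_Chat:
  assumes "g \<ge> 1" "n \<ge> 1" "length bs = n"
    and "int (sum_list bs) \<ge> 2 * int g - 3" "sum_list bs + 2 * k = 4 * g + n - 3"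
  shows "hurwitz_coeff g n bs = C_const (sum_list bs) g n * Chat g bs"
proof -
  define K where "K = sum_list bs + 3 - 2 * g"
  have K_eqs: "K + 2 * k = 2 * g + n" "int (sum_list bs) + 3 - 2 * int g = int K"
    "sum_list bs + n = 2 * g + n - 3 + K" "2 * g + n - 3 + 2 * g - sum_list bs = 2 * k"
    using assms unfolding K_def by linarith+
  have "hurwitz_coeff g n bs = fps_nth (inverse (sinhc_fps 1)) (2 * k) * (fact (2 * g + n - 3) / 2 ^ K)
      * coeff (\<Prod>i<n. central_diff_poly (bs ! i)) (2 * g + n - 3)"
    using assms(3) K_eqs(4) assms(5)
    by (simp add: hurwitz_coeff_def sinhc_prod_coeffs_def K_eqs(3) power_add)
  then show ?thesis
    unfolding C_const_eq_inverse_sinhc_nth[OF K_eqs(1,2)] Chat_eq_coeff[OF assms(3) K_eqs(2)] by simp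
qed

lemma hurwitz_coeff_eq_multinomial:
  assumes "g \<ge> 1" "length bs = n" "sum_list bs = 2 * g + n - 3"
  shows "hurwitz_coeff g n bs
    = multinomial_coeff bs * (1 - 2 ^ (2*g-1)) / (2 ^ (2*g-1) * fact (2*g)) * bernoulli_num (2*g)"
proof -
  have "hurwitz_coeff g n bs = fps_nth (inverse (sinhc_fps 1)) (2 * g) * multinomial_coeff bs"
    using coeff_prod_central_diff_poly_top[OF assms(2)] assms(2)
    by (simp add: hurwitz_coeff_def sinhc_prod_coeffs_def multinomial_coeff_def power_add flip: assms(3))
  also have "fps_nth (inverse (sinhc_fps 1)) (2 * g)
      = (2 / 2 ^ (2 * g) - 1) * (bernoulli_num (2 * g) / fact (2 * g))"
    unfolding inverse_sinhc_nth bernoulli_fps_nth ..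
  also have "(2::real) / 2 ^ (2 * g) - 1 = (1 - 2 ^ (2*g-1)) / 2 ^ (2*g-1)"
    using assms(1) by (cases g) (auto simp: field_simps)
  finally show ?thesis by simp
qed

lemma dbracket_eq_0_if_even:
  assumes "g \<ge> 1" "even (sum_list bs + length bs)"
  shows "dbracket c g bs k = 0"
proof -
  have "sum_list bs + 2 * k \<noteq> 4 * g - 3 + length bs"
  proof
    assume "sum_list bs + 2 * k = 4 * g - 3 + length bs"
    then have "(sum_list bs + length bs) + 2 * k + 3 = 4 * g + 2 * length bs" using assms(1) by simp
    then show False using assms(2) by presburger
  qed
  then show ?thesis by (simp add: dbracket_def)
qed

lemma dbracket_hurwitz_coeff_eq_C_const_Chat:
  assumes "g \<ge> 1" "n \<ge> 1" "length bs = n"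
    and "int (sum_list bs) \<ge> 2 * int g - 3" "sum_list bs + 2 * k = 4 * g + n - 3"
  shows "(-1) ^ ((4*g-3+n - sum_list bs) div 2) * dbracket (hurwitz_coeff g n) g bs k
    = C_const (sum_list bs) g n * Chat g bs"
proof -
  have "sum_list bs + 2 * k = 4 * g - 3 + length bs" "(4*g-3+n - sum_list bs) div 2 = k"
    using assms by auto
  then show ?thesis
    using hurwitz_coeff_eq_C_const_Chat[OF assms] by (simp add: dbracket_def flip: mult.assoc power_add)
qed

lemma dbracket_hurwitz_coeff_eq_multinomial:
  assumes "g \<ge> 1" "n \<ge> 1" "length bs = n" "sum_list bs = 2 * g + n - 3"
  shows "dbracket (hurwitz_coeff g n) g bs g = (-1) ^ g * multinomial_coeff bs *
    (1 - 2 ^ (2*g-1)) / (2 ^ (2*g-1) * fact (2*g)) * bernoulli_num (2*g)"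
proof -
  have "sum_list bs + 2 * g = 4 * g - 3 + length bs" using assms by auto
  then show ?thesis
    using hurwitz_coeff_eq_multinomial[OF assms(1,3,4)] by (simp add: dbracket_def)
qed

theorem theorem3p8:
  fixes g n :: nat
  assumes "g \<ge> 1" and "n \<ge> 1"
  shows "\<exists>c. is_poly_coeffs n c \<and>
     (\<forall>\<beta>. length \<beta> = n \<and> (\<forall>i\<in>set \<beta>. i > 0) \<longrightarrow>
        H_dd g \<beta> / (fact (2*g+n-1) * real (sum_list \<beta>)) = poly_eval c \<beta>) \<and>
     symmetric_coeffs n c \<and>
     (\<exists>e. c e \<noteq> 0 \<and> sum_list e = 4*g+n-3) \<and> (\<forall>e. c e \<noteq> 0 \<longrightarrow> sum_list e \<le> 4*g+n-3) \<and>
     (\<exists>e. c e \<noteq> 0 \<and> sum_list e = 2*g+n-3) \<and> (\<forall>e. c e \<noteq> 0 \<longrightarrow> sum_list e \<ge> 2*g+n-3) \<and>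
     (\<forall>bs k. length bs = n \<and> int (sum_list bs) \<ge> 2 * int g - 3 \<and>
        sum_list bs + 2 * k = 4*g+n-3 \<longrightarrow>
        (-1) ^ ((4*g-3+n - sum_list bs) div 2) * dbracket c g bs k
          = C_const (sum_list bs) g n * Chat g bs) \<and>
     (\<forall>bs k. length bs = n \<and> even (sum_list bs + n) \<longrightarrow> dbracket c g bs k = 0) \<and>
     (\<forall>bs. length bs = n \<and> sum_list bs = 2*g+n-3 \<longrightarrow>
        dbracket c g bs g = (-1) ^ g * multinomial_coeff bs *
          (1 - 2 ^ (2*g-1)) / (2 ^ (2*g-1) * fact (2*g)) * bernoulli_num (2*g))"
proof (intro exI[of _ "hurwitz_coeff g n"] conjI)
  let ?c = "hurwitz_coeff g n"
  show "is_poly_coeffs n ?c" "symmetric_coeffs n ?c"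
    unfolding hurwitz_coeff_def by (rule is_poly_sinhc_prod_coeffs symmetric_sinhc_prod_coeffs)+
  show "\<forall>\<beta>. length \<beta> = n \<and> (\<forall>i\<in>set \<beta>. i > 0) \<longrightarrow>
      H_dd g \<beta> / (fact (2*g+n-1) * real (sum_list \<beta>)) = poly_eval ?c \<beta>"
    using H_dd_eq_poly_eval_hurwitz_coeff[OF assms] by blast
  show "\<exists>e. ?c e \<noteq> 0 \<and> sum_list e = 4*g+n-3"
    by (rule hurwitz_coeff_attains_highest_degree[OF assms])
  show "\<exists>e. ?c e \<noteq> 0 \<and> sum_list e = 2*g+n-3"
    by (rule hurwitz_coeff_attains_lowest_degree[OF assms])
  show "\<forall>e. ?c e \<noteq> 0 \<longrightarrow> sum_list e \<le> 4*g+n-3" "\<forall>e. ?c e \<noteq> 0 \<longrightarrow> sum_list e \<ge> 2*g+n-3"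
    using hurwitz_coeff_degree_bounds[OF assms] by blast+
qed (use dbracket_hurwitz_coeff_eq_C_const_Chat[OF assms] dbracket_eq_0_if_even[OF assms(1)]
      dbracket_hurwitz_coeff_eq_multinomial[OF assms] in auto)

end
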